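(* Let $G$ be the toroidal $L$-grid with $n=L^2$ vertices and fix $\lambda>1$. For every positive integer $r\le L-2$, if $q\ge 2^{r^2+8r+3}r^{2r^2+4r+1}\lambda^{2+\frac2r}$, then for every $\varepsilon>0$, $$\tau(\mathcal{M}_{\mathrm{GD}}(G,\lambda,q),\varepsilon)\le 4(4\lambda^8)^{r^2+1}\,n^2\log(2en)\left(n\log(4\lambda^6)+\log(\varepsilon^{-1})\right).$$
   Context: The toroidal $L$-grid has vertex set $(\mathbb{Z}/L\mathbb{Z})^2$ with $(a,b)\sim(c,d)$ iff ($a-c=\pm1$ and $b=d$) or ($b-d=\pm1$ and $a=c$) in $\mathbb{Z}/L\mathbb{Z}$. Potts model: configurations $\sigma\in[q]^V$, $\mu(\sigma)$ = number of monochromatic edges, Gibbs distribution $\pi(\sigma)\propto\lambda^{\mu(\sigma)}$. Glauber dynamics $\mathcal{M}_{\mathrm{GD}}(G,\lambda,q)$: from $X_t$ choose a uniformly random vertex $v$, choose $c\in[q]$ with probability proportional to $\lambda^{n(X_t,v,c)}$ ($n(X,v,c)$ = number of neighbours of $v$ coloured $c$ in $X$), and recolour $v$ with $c$. $\tau(\mathcal{M},\varepsilon)=\max_x\min\{t:\|P^t(x,\cdot)-\pi\|_{TV}\le\varepsilon\}$.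
   Formalization: The bound is proved for 0 < ε < 1 instead of every ε > 0; for ε ≥ 1 the mixing time is 0, and for ε > (4λ^6)^n the right-hand side is negative, so the claim as written fails there. *)

theory Defs
  imports Complex_Main "HOL-Library.FuncSet"
begin

definition torus_V :: "nat \<Rightarrow> (nat \<times> nat) set" where
  "torus_V L = {..<L} \<times> {..<L}"

definition torus_adj :: "nat \<Rightarrow> nat \<times> nat \<Rightarrow> nat \<times> nat \<Rightarrow> bool" where
  "torus_adj L u v \<longleftrightarrow> u \<in> torus_V L \<and> v \<in> torus_V L \<and>
     (((fst u = (fst v + 1) mod L \<or> fst v = (fst u + 1) mod L) \<and> snd u = snd v) \<or>
      ((snd u = (snd v + 1) mod L \<or> snd v = (snd u + 1) mod L) \<and> fst u = fst v))"

definition torus_E :: "nat \<Rightarrow> (nat \<times> nat) set set" where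
  "torus_E L = {{u, v} | u v. torus_adj L u v}"

definition configs :: "nat \<Rightarrow> nat \<Rightarrow> (nat \<times> nat \<Rightarrow> nat) set" where
  "configs L q = PiE (torus_V L) (\<lambda>_. {..<q})"

definition mono_edges :: "nat \<Rightarrow> (nat \<times> nat \<Rightarrow> nat) \<Rightarrow> nat" where
  "mono_edges L \<sigma> = card {e \<in> torus_E L. \<exists>c. \<forall>u\<in>e. \<sigma> u = c}"

definition gibbs :: "nat \<Rightarrow> real \<Rightarrow> nat \<Rightarrow> (nat \<times> nat \<Rightarrow> nat) \<Rightarrow> real" where
  "gibbs L lam q \<sigma> = lam ^ mono_edges L \<sigma> / (\<Sum>\<tau>\<in>configs L q. lam ^ mono_edges L \<tau>)"

definition nbr_count :: "nat \<Rightarrow> (nat \<times> nat \<Rightarrow> nat) \<Rightarrow> nat \<times> nat \<Rightarrow> nat \<Rightarrow> nat" where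
  "nbr_count L X v c = card {u \<in> torus_V L. torus_adj L v u \<and> X u = c}"

definition glauber_P :: "nat \<Rightarrow> real \<Rightarrow> nat \<Rightarrow> (nat \<times> nat \<Rightarrow> nat) \<Rightarrow> (nat \<times> nat \<Rightarrow> nat) \<Rightarrow> real" where
  "glauber_P L lam q X Y =
     (1 / real (card (torus_V L))) *
     (\<Sum>v\<in>torus_V L. \<Sum>c<q.
        (if Y = X(v := c)
         then lam ^ nbr_count L X v c / (\<Sum>c'<q. lam ^ nbr_count L X v c')
         else 0))"

fun glauber_Pt :: "nat \<Rightarrow> real \<Rightarrow> nat \<Rightarrow> nat \<Rightarrow> (nat \<times> nat \<Rightarrow> nat) \<Rightarrow> (nat \<times> nat \<Rightarrow> nat) \<Rightarrow> real" where
  "glauber_Pt L lam q 0 X Y = (if X = Y then 1 else 0)"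
| "glauber_Pt L lam q (Suc t) X Y =
     (\<Sum>Z\<in>configs L q. glauber_Pt L lam q t X Z * glauber_P L lam q Z Y)"

definition tv_dist :: "nat \<Rightarrow> real \<Rightarrow> nat \<Rightarrow> nat \<Rightarrow> (nat \<times> nat \<Rightarrow> nat) \<Rightarrow> real" where
  "tv_dist L lam q t X = (1/2) * (\<Sum>Y\<in>configs L q. \<bar>glauber_Pt L lam q t X Y - gibbs L lam q Y\<bar>)"

definition mixing_time :: "nat \<Rightarrow> real \<Rightarrow> nat \<Rightarrow> real \<Rightarrow> nat" where
  "mixing_time L lam q \<epsilon> =
     Max ((\<lambda>X. LEAST t. tv_dist L lam q t X \<le> \<epsilon>) ` configs L q)"

end

theory Submission
  imports Defs "HOL-Analysis.Convex" "HOL-Number_Theory.Cong"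
begin

text \<open>
  Consider the heat-bath dynamics on the \<open>r \<times> r\<close> blocks of the torus. Let \<open>S\<close> be the set of
  vertices of a block that carry a given colour. Counting row by row and column by column, at most
  \<open>(2 + 2/r) |S|\<close> monochromatic edges meet \<open>S\<close>, so recolouring \<open>S\<close> freely shows that this set has
  conditional probability at most \<open>x ^ |S|\<close> with \<open>x = \<lambda> powr (2 + 2/r) / q\<close>, whatever the boundary
  condition. Hence with probability close to 1 the block avoids both colours involved in a change of
  one boundary spin, and the block dynamics contracts Lipschitz constants by the factor
  \<open>1 - r\<^sup>2/(2n)\<close>.

  By reversibility \<open>\<parallel>P\<^sup>t f\<parallel>\<^sup>2\<close> is log-convex in \<open>t\<close>, so contraction of Lipschitz constants by the
  block update \<open>P\<close> implies contraction in \<open>L\<^sup>2(\<pi>)\<close> at the same rate, that is a spectral gap.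
  Comparing a block with a product measure bounds its variance by \<open>\<lambda> ^ (4r\<^sup>2)\<close> times the sum of its
  single-site variances, which gives a gap for the Glauber dynamics and, if \<open>q < 64 \<lambda>\<^sup>4\<close>, the
  mixing time bound. For \<open>q \<ge> 64 \<lambda>\<^sup>4\<close> the single-site blocks already contract, and the resulting
  bound does not depend on \<open>q\<close>.
\<close>

section \<open>Conditional expectations on finite product spaces\<close>

locale config_space =
  fixes I :: "'i set" and A :: "'a set"
  assumes finite_sites: "finite I" and finite_spins: "finite A"
begin

definition states :: "('i \<Rightarrow> 'a) set" where
  "states = PiE I (\<lambda>_. A)"

definition fibre :: "'i set \<Rightarrow> ('i \<Rightarrow> 'a) \<Rightarrow> ('i \<Rightarrow> 'a) set" where
  "fibre B X = {Y \<in> states. \<forall>u. u \<notin> B \<longrightarrow> Y u = X u}"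

definition invariant :: "'i set \<Rightarrow> (('i \<Rightarrow> 'a) \<Rightarrow> real) \<Rightarrow> bool" where
  "invariant B h \<longleftrightarrow> (\<forall>X\<in>states. \<forall>Y\<in>fibre B X. h Y = h X)"

definition site_lipschitz :: "(('i \<Rightarrow> 'a) \<Rightarrow> real) \<Rightarrow> real \<Rightarrow> bool" where
  "site_lipschitz f l \<longleftrightarrow> (\<forall>v\<in>I. \<forall>X\<in>states. \<forall>Y\<in>fibre {v} X. \<bar>f X - f Y\<bar> \<le> l)"

lemma finite_states [simp]: "finite states"
  unfolding states_def using finite_sites finite_spins by (intro finite_PiE) auto

lemma states_apply: "X \<in> states \<Longrightarrow> v \<in> I \<Longrightarrow> X v \<in> A"
  by (auto simp: states_def)

lemma fibre_subset: "fibre B X \<subseteq> states"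
  by (auto simp: fibre_def)

lemma fibre_in_states: "Y \<in> fibre B X \<Longrightarrow> Y \<in> states"
  by (simp add: fibre_def)

lemma finite_fibre [simp]: "finite (fibre B X)"
  using fibre_subset finite_states by (rule finite_subset)

lemma fibre_outside: "Y \<in> fibre B X \<Longrightarrow> u \<notin> B \<Longrightarrow> Y u = X u"
  by (simp add: fibre_def)

lemma fibre_refl: "X \<in> states \<Longrightarrow> X \<in> fibre B X"
  by (simp add: fibre_def)

lemma fibre_eq: "Y \<in> fibre B X \<Longrightarrow> fibre B Y = fibre B X"
  by (auto simp: fibre_def)

lemma fibre_mono: "C \<subseteq> B \<Longrightarrow> fibre C X \<subseteq> fibre B X"
  by (auto simp: fibre_def)

lemma fibre_empty: "X \<in> states \<Longrightarrow> fibre {} X = {X}"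
  by (auto simp: fibre_def)

lemma fibre_all_sites: "X \<in> states \<Longrightarrow> fibre I X = states"
  by (auto simp: fibre_def states_def PiE_def extensional_def)

lemma upd_in_states: "v \<in> I \<Longrightarrow> X \<in> states \<Longrightarrow> c \<in> A \<Longrightarrow> X(v := c) \<in> states"
  by (auto simp: states_def PiE_def Pi_def extensional_def)

lemma upd_in_fibre:
  "v \<in> I \<Longrightarrow> Y \<in> fibre B X \<Longrightarrow> c \<in> A \<Longrightarrow> Y(v := c) \<in> fibre B (X(v := c))"
  using upd_in_states[of v Y c] by (auto simp: fibre_def)

lemma fibre_singleton:
  assumes "v \<in> I" "X \<in> states"
  shows "fibre {v} X = (\<lambda>c. X(v := c)) ` A"
proof (intro equalityI subsetI)
  fix Y assume Y: "Y \<in> fibre {v} X"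
  then have "Y = X(v := Y v)" by (auto simp: fibre_def)
  then show "Y \<in> (\<lambda>c. X(v := c)) ` A"
    using states_apply[OF fibre_in_states[OF Y] assms(1)] by blast
qed (use assms upd_in_states in \<open>auto simp: fibre_def\<close>)

lemma fibre_insertE:
  assumes "v \<in> I" "X \<in> states" "Y \<in> fibre (insert v B) X"
  obtains Z where "Z \<in> fibre B X" "Y \<in> fibre {v} Z"
proof
  have "Y(v := X v) \<in> states"
    using assms by (intro upd_in_states states_apply) (auto dest: fibre_in_states)
  then show "Y(v := X v) \<in> fibre B X"
    using assms(3) by (auto simp: fibre_def)
  show "Y \<in> fibre {v} (Y(v := X v))"
    using assms(3) by (auto simp: fibre_def)
qed

lemma fibre_boundary_change:
  assumes v: "v \<in> I" "v \<notin> B" and X: "X \<in> states" and Y: "Y \<in> fibre {v} X"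
  shows "bij_betw (\<lambda>s. s(v := Y v)) (fibre B X) (fibre B Y)"
proof (rule bij_betw_byWitness[where f' = "\<lambda>t. t(v := X v)"])
  have YX: "X(v := Y v) = Y" "Y(v := X v) = X"
    using fibre_outside[OF Y] by (auto simp: fun_eq_iff)
  have spins: "X v \<in> A" "Y v \<in> A"
    using states_apply[OF _ v(1)] X fibre_in_states[OF Y] by auto
  show "\<forall>s\<in>fibre B X. (s(v := Y v))(v := X v) = s" "\<forall>t\<in>fibre B Y. (t(v := X v))(v := Y v) = t"
    using fibre_outside[OF _ v(2)] by (auto intro!: fun_upd_idem)
  show "(\<lambda>s. s(v := Y v)) ` fibre B X \<subseteq> fibre B Y" "(\<lambda>t. t(v := X v)) ` fibre B Y \<subseteq> fibre B X"
    using upd_in_fibre[OF v(1) _ spins(2), of _ B X] upd_in_fibre[OF v(1) _ spins(1), of _ B Y]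
    by (auto simp: YX)
qed

lemma card_fibre:
  assumes B: "B \<subseteq> I" and X: "X \<in> states"
  shows "card (fibre B X) = card A ^ card B"
proof -
  have "bij_betw (\<lambda>Y. restrict Y B) (fibre B X) (PiE B (\<lambda>_. A))"
  proof (rule bij_betw_byWitness[where f' = "\<lambda>g. override_on X g B"])
    show "\<forall>Y\<in>fibre B X. override_on X (restrict Y B) B = Y"
      by (auto simp: fibre_def override_on_def fun_eq_iff)
    show "\<forall>g\<in>PiE B (\<lambda>_. A). restrict (override_on X g B) B = g"
      by (auto simp: override_on_def fun_eq_iff PiE_def extensional_def)
    show "(\<lambda>Y. restrict Y B) ` fibre B X \<subseteq> PiE B (\<lambda>_. A)"
      using B by (auto simp: fibre_def states_def)
    show "(\<lambda>g. override_on X g B) ` PiE B (\<lambda>_. A) \<subseteq> fibre B X"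
      using B X by (auto simp: fibre_def states_def override_on_def PiE_def Pi_def extensional_def)
  qed
  then have "card (fibre B X) = card (PiE B (\<lambda>_. A))" by (rule bij_betw_same_card)
  then show ?thesis using finite_subset[OF B finite_sites] by (simp add: card_PiE)
qed

lemma invariant_mono: "invariant B h \<Longrightarrow> C \<subseteq> B \<Longrightarrow> invariant C h"
  unfolding invariant_def using fibre_mono by blast

lemma invariant_insert:
  assumes "v \<in> I" "invariant B h" "invariant {v} h"
  shows "invariant (insert v B) h"
  unfolding invariant_def
proof (intro ballI)
  fix X Y assume X: "X \<in> states" and "Y \<in> fibre (insert v B) X"
  then obtain Z where "Z \<in> fibre B X" "Y \<in> fibre {v} Z" by (rule fibre_insertE[OF assms(1)])
  then show "h Y = h X"
    using X assms(2,3) fibre_in_states[of Z B X] by (simp add: invariant_def)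
qed

lemma site_lipschitz_nonneg:
  assumes "site_lipschitz f l" "v \<in> I" "X \<in> states"
  shows "0 \<le> l"
  using assms fibre_refl[of X "{v}"] by (fastforce simp: site_lipschitz_def)

lemma site_lipschitz_exists: "\<exists>l. site_lipschitz f l"
proof (intro exI)
  have le: "\<bar>f X\<bar> \<le> (\<Sum>X\<in>states. \<bar>f X\<bar>)" if "X \<in> states" for X
    using that by (intro member_le_sum) auto
  have "\<bar>f X - f Y\<bar> \<le> 2 * (\<Sum>X\<in>states. \<bar>f X\<bar>)" if "X \<in> states" "Y \<in> states" for X Y
    using le[OF that(1)] le[OF that(2)] by linarith
  then show "site_lipschitz f (2 * (\<Sum>X\<in>states. \<bar>f X\<bar>))"
    unfolding site_lipschitz_def using fibre_subset by blast
qed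

lemma site_lipschitz_on_fibre:
  assumes f: "site_lipschitz f l" and X: "X \<in> states" and "B \<subseteq> I" "Y \<in> fibre B X"
  shows "\<bar>f X - f Y\<bar> \<le> real (card B) * l"
  using finite_subset[OF assms(3) finite_sites] assms(3,4)
proof (induction B arbitrary: Y rule: finite_induct)
  case empty
  then show ?case using X by (simp add: fibre_empty)
next
  case (insert v B)
  then have v: "v \<in> I" by simp
  obtain Z where Z: "Z \<in> fibre B X" "Y \<in> fibre {v} Z"
    by (rule fibre_insertE[OF v X insert.prems(2)])
  have "\<bar>f X - f Z\<bar> \<le> real (card B) * l"
    using insert.prems by (intro insert.IH Z) simp
  moreover have "\<bar>f Z - f Y\<bar> \<le> l"
    using f v Z fibre_in_states unfolding site_lipschitz_def by blast
  ultimately show ?case using insert.hyps by (simp add: algebra_simps)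
qed

end

locale spin_system = config_space I A
  for I :: "'i set" and A :: "'a set" +
  fixes w :: "('i \<Rightarrow> 'a) \<Rightarrow> real"
  assumes weight_pos: "X \<in> states \<Longrightarrow> 0 < w X"
begin

definition cond_exp :: "'i set \<Rightarrow> (('i \<Rightarrow> 'a) \<Rightarrow> real) \<Rightarrow> ('i \<Rightarrow> 'a) \<Rightarrow> real" where
  "cond_exp B f X = (\<Sum>Y\<in>fibre B X. w Y * f Y) / (\<Sum>Y\<in>fibre B X. w Y)"

definition weighted_inner :: "(('i \<Rightarrow> 'a) \<Rightarrow> real) \<Rightarrow> (('i \<Rightarrow> 'a) \<Rightarrow> real) \<Rightarrow> real"
  (\<open>\<langle>_, _\<rangle>\<close>) where
  "\<langle>f, g\<rangle> = (\<Sum>X\<in>states. w X * f X * g X)"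

abbreviation sq_norm :: "(('i \<Rightarrow> 'a) \<Rightarrow> real) \<Rightarrow> real" where
  "sq_norm f \<equiv> \<langle>f, f\<rangle>"

definition cond_variance :: "'i set \<Rightarrow> (('i \<Rightarrow> 'a) \<Rightarrow> real) \<Rightarrow> real" where
  "cond_variance B f = sq_norm (\<lambda>X. f X - cond_exp B f X)"

lemma sum_fibre_pos: "X \<in> states \<Longrightarrow> 0 < (\<Sum>Y\<in>fibre B X. w Y)"
  using fibre_refl[of X B] by (intro sum_pos) (auto intro: weight_pos fibre_in_states)

lemma cond_exp_invariant: "invariant B (cond_exp B f)"
  by (auto simp: invariant_def cond_exp_def dest: fibre_eq)

lemma cond_exp_of_invariant:
  assumes "invariant B h" "X \<in> states"
  shows "cond_exp B h X = h X"
proof -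
  have "(\<Sum>Y\<in>fibre B X. w Y * h Y) = (\<Sum>Y\<in>fibre B X. w Y) * h X"
    using assms by (simp add: invariant_def sum_distrib_right)
  then show ?thesis using sum_fibre_pos[OF assms(2), of B] by (simp add: cond_exp_def)
qed

lemma cond_exp_cong: "(\<And>X. X \<in> states \<Longrightarrow> f X = g X) \<Longrightarrow> cond_exp B f X = cond_exp B g X"
  by (simp add: cond_exp_def fibre_in_states)

lemma cond_exp_diff: "cond_exp B (\<lambda>Y. f Y - g Y) X = cond_exp B f X - cond_exp B g X"
  by (simp add: cond_exp_def right_diff_distrib sum_subtractf diff_divide_distrib)

lemma cond_exp_sum:
  "cond_exp B (\<lambda>Z. \<Sum>y\<in>S. g y Z * a y) X = (\<Sum>y\<in>S. cond_exp B (g y) X * a y)"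
proof -
  have "(\<Sum>Z\<in>fibre B X. w Z * (\<Sum>y\<in>S. g y Z * a y)) = (\<Sum>y\<in>S. (\<Sum>Z\<in>fibre B X. w Z * g y Z) * a y)"
    by (simp add: sum_distrib_left sum_distrib_right mult.assoc sum.swap[of _ S])
  then show ?thesis by (simp add: cond_exp_def sum_divide_distrib flip: times_divide_eq_left)
qed

lemma cond_exp_singleton:
  assumes "v \<in> I" "X \<in> states"
  shows "cond_exp {v} f X = (\<Sum>c\<in>A. w (X(v := c)) * f (X(v := c))) / (\<Sum>c\<in>A. w (X(v := c)))"
proof -
  have "inj_on (\<lambda>c. X(v := c)) A" by (metis fun_upd_same inj_onI)
  then show ?thesis unfolding cond_exp_def fibre_singleton[OF assms] by (simp add: sum.reindex)
qed

lemma inner_cong: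
  "\<lbrakk>\<And>X. X \<in> states \<Longrightarrow> f X = f' X; \<And>X. X \<in> states \<Longrightarrow> g X = g' X\<rbrakk> \<Longrightarrow> \<langle>f, g\<rangle> = \<langle>f', g'\<rangle>"
  by (simp add: weighted_inner_def)

lemma inner_commute: "\<langle>f, g\<rangle> = \<langle>g, f\<rangle>"
  by (simp add: weighted_inner_def mult_ac)

lemma inner_diff_right: "\<langle>f, \<lambda>X. g X - h X\<rangle> = \<langle>f, g\<rangle> - \<langle>f, h\<rangle>"
  by (simp add: weighted_inner_def right_diff_distrib sum_subtractf)

lemma inner_diff_left: "\<langle>\<lambda>X. g X - h X, f\<rangle> = \<langle>g, f\<rangle> - \<langle>h, f\<rangle>"
  using inner_diff_right[of f g h] by (simp add: inner_commute)

lemma sq_norm_add: "sq_norm (\<lambda>X. f X + g X) = sq_norm f + 2 * \<langle>f, g\<rangle> + sq_norm g"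
  unfolding weighted_inner_def sum_distrib_left sum.distrib[symmetric]
  by (intro sum.cong refl) (simp add: algebra_simps)

lemma weighted_square_nonneg: "X \<in> states \<Longrightarrow> 0 \<le> w X * f X * f X"
  using weight_pos[of X] by (simp add: mult.assoc)

lemma sq_norm_nonneg: "0 \<le> sq_norm f"
  unfolding weighted_inner_def by (intro sum_nonneg weighted_square_nonneg)

lemma inner_Cauchy_Schwarz: "\<langle>f, g\<rangle>\<^sup>2 \<le> sq_norm f * sq_norm g"
proof -
  have w: "sqrt (w X) * sqrt (w X) = w X" if "X \<in> states" for X
    using weight_pos[OF that] by simp
  have "\<langle>f, g\<rangle> = (\<Sum>X\<in>states. (sqrt (w X) * f X) * (sqrt (w X) * g X))" for f g
    unfolding weighted_inner_def
  proof (rule sum.cong[OF refl])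
    fix X assume "X \<in> states"
    then have "w X * f X * g X = (sqrt (w X) * sqrt (w X)) * f X * g X" by (simp only: w)
    then show "w X * f X * g X = (sqrt (w X) * f X) * (sqrt (w X) * g X)" by (simp only: mult_ac)
  qed
  then show ?thesis
    using Cauchy_Schwarz_ineq_sum[of "\<lambda>X. sqrt (w X) * f X" "\<lambda>X. sqrt (w X) * g X" states]
    by (simp only: power2_eq_square)
qed

lemma cond_exp_self_adjoint: "\<langle>cond_exp B f, g\<rangle> = \<langle>f, cond_exp B g\<rangle>"
proof -
  define Z where "Z X = (\<Sum>Y\<in>fibre B X. w Y)" for X
  let ?term = "\<lambda>X Y. w X * w Y * f Y * g X / Z X"
  have fibre_swap: "{X \<in> states. Y \<in> fibre B X} = fibre B Y" if "Y \<in> states" for Y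
    using that by (auto simp: fibre_def)
  have "\<langle>cond_exp B f, g\<rangle> = (\<Sum>X\<in>states. \<Sum>Y | Y \<in> states \<and> Y \<in> fibre B X. ?term X Y)"
    by (simp add: weighted_inner_def cond_exp_def Z_def sum_distrib_left sum_distrib_right
        sum_divide_distrib mult_ac fibre_def)
  also have "\<dots> = (\<Sum>Y\<in>states. \<Sum>X | X \<in> states \<and> Y \<in> fibre B X. ?term X Y)"
    by (rule sum.swap_restrict) simp_all
  also have "\<dots> = (\<Sum>Y\<in>states. \<Sum>X\<in>fibre B Y. w Y * f Y * (w X * g X) / Z Y)"
    by (intro sum.cong fibre_swap) (simp_all add: Z_def fibre_eq mult_ac)
  also have "\<dots> = \<langle>f, cond_exp B g\<rangle>"
    by (simp add: weighted_inner_def cond_exp_def Z_def sum_distrib_left sum_divide_distrib)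
  finally show ?thesis .
qed

lemma inner_cond_exp_cond_exp: "\<langle>cond_exp B f, cond_exp B g\<rangle> = \<langle>f, cond_exp B g\<rangle>"
  unfolding cond_exp_self_adjoint
  by (intro inner_cong refl cond_exp_of_invariant cond_exp_invariant)

lemma cond_variance_eq: "cond_variance B f = sq_norm f - \<langle>f, cond_exp B f\<rangle>"
  using inner_cond_exp_cond_exp[of B f f]
  by (simp add: cond_variance_def inner_diff_left inner_diff_right
      inner_commute[of "cond_exp B f" f])

lemma cond_variance_le_sq_norm: "cond_variance B f \<le> sq_norm f"
  using sq_norm_nonneg[of "cond_exp B f"] by (simp add: cond_variance_eq inner_cond_exp_cond_exp)

lemma sq_norm_cond_exp_le: "sq_norm (cond_exp B f) \<le> sq_norm f"
  using sq_norm_nonneg[of "\<lambda>X. f X - cond_exp B f X"]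
  by (simp add: cond_variance_eq inner_cond_exp_cond_exp flip: cond_variance_def)

lemma cond_exp_best_approximation:
  assumes "invariant B h"
  shows "cond_variance B f \<le> sq_norm (\<lambda>X. f X - h X)"
proof -
  have "cond_variance B f = cond_variance B (\<lambda>X. f X - h X)"
    unfolding cond_variance_def
    using cond_exp_of_invariant[OF assms] by (intro inner_cong) (auto simp: cond_exp_diff)
  also have "\<dots> \<le> sq_norm (\<lambda>X. f X - h X)" by (rule cond_variance_le_sq_norm)
  finally show ?thesis .
qed

end

section \<open>Comparison of a block with its sites\<close>

context spin_system
begin

lemma cond_exp_preserves_invariant:
  assumes "v \<in> I" "invariant B w" "invariant B h"
  shows "invariant B (cond_exp {v} h)"
  unfolding invariant_def
proof (intro ballI)
  fix X Y assume X: "X \<in> states" and Y: "Y \<in> fibre B X"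
  have upd_eq: "g (Y(v := c)) = g (X(v := c))" if "invariant B g" "c \<in> A" for g c
    using that upd_in_states[OF assms(1) X] upd_in_fibre[OF assms(1) Y]
    by (auto simp: invariant_def)
  show "cond_exp {v} h Y = cond_exp {v} h X"
    using assms by (simp add: cond_exp_singleton X fibre_in_states[OF Y] upd_eq cong: sum.cong)
qed

lemma sq_norm_diff_cond_exp_le:
  "sq_norm (\<lambda>X. f X - cond_exp B h X) \<le> cond_variance B f + sq_norm (\<lambda>X. f X - h X)"
proof -
  let ?res = "\<lambda>X. f X - cond_exp B f X" and ?g = "\<lambda>X. f X - h X"
  have "sq_norm (\<lambda>X. f X - cond_exp B h X) = sq_norm (\<lambda>X. ?res X + cond_exp B ?g X)"
    by (intro inner_cong) (simp_all add: cond_exp_diff)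
  also have "\<dots> = sq_norm ?res + 2 * \<langle>?res, cond_exp B ?g\<rangle> + sq_norm (cond_exp B ?g)"
    by (rule sq_norm_add)
  also have "\<langle>?res, cond_exp B ?g\<rangle> = 0"
    by (simp add: inner_diff_left inner_cond_exp_cond_exp)
  finally show ?thesis
    using sq_norm_cond_exp_le[of B ?g] by (simp add: cond_variance_def)
qed

text \<open>For a weight that is constant on the fibres of \<open>B\<close>, the conditional expectations at the sites
  of \<open>B\<close> are uniform averages, which preserve invariance at the other sites.\<close>

lemma invariant_approximation:
  assumes "B \<subseteq> I" "invariant B w"
  shows "\<exists>h. invariant B h \<and> sq_norm (\<lambda>X. f X - h X) \<le> (\<Sum>v\<in>B. cond_variance {v} f)"
  using finite_subset[OF assms(1) finite_sites] assms
proof (induction B rule: finite_induct)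
  case empty
  have "invariant {} f" by (simp add: invariant_def fibre_empty)
  then show ?case by (intro exI[of _ f]) (simp add: weighted_inner_def)
next
  case (insert v B)
  have w: "invariant B w" and v: "v \<in> I"
    using insert.prems invariant_mono[of "insert v B" w B] by auto
  obtain h where h: "invariant B h" "sq_norm (\<lambda>X. f X - h X) \<le> (\<Sum>v\<in>B. cond_variance {v} f)"
    using insert.IH[OF _ w] insert.prems(1) by blast
  have "invariant (insert v B) (cond_exp {v} h)"
    by (rule invariant_insert[OF v cond_exp_preserves_invariant[OF v w h(1)] cond_exp_invariant])
  moreover have "sq_norm (\<lambda>X. f X - cond_exp {v} h X) \<le> (\<Sum>u\<in>insert v B. cond_variance {u} f)"
    using sq_norm_diff_cond_exp_le[of f "{v}" h] h(2) insert.hyps by simp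
  ultimately show ?case by blast
qed

lemma invariant_minorant:
  assumes K: "\<And>X Y. X \<in> states \<Longrightarrow> Y \<in> fibre B X \<Longrightarrow> w X \<le> K * w Y"
  obtains m where "spin_system I A m" "invariant B m"
    "\<And>X. X \<in> states \<Longrightarrow> m X \<le> w X" "\<And>X. X \<in> states \<Longrightarrow> w X \<le> K * m X"
proof -
  define m where "m X = Min (w ` fibre B X)" for X
  have m_attained: "m X \<in> w ` fibre B X" if "X \<in> states" for X
    unfolding m_def using fibre_refl[OF that] by (intro Min_in finite_imageI finite_fibre) blast
  show thesis
  proof (rule that[of m])
    show "spin_system I A m"
    proof
      fix X assume "X \<in> states"
      from m_attained[OF this] show "0 < m X" by (auto dest!: fibre_in_states intro: weight_pos)
    qed
    show "invariant B m"
      by (simp add: invariant_def m_def fibre_eq)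
    show "m X \<le> w X" if "X \<in> states" for X
      unfolding m_def using fibre_refl[OF that] by (intro Min_le finite_imageI finite_fibre imageI)
    show "w X \<le> K * m X" if X: "X \<in> states" for X
    proof -
      obtain Y where "Y \<in> fibre B X" "m X = w Y" using m_attained[OF X] by blast
      then show ?thesis using K[OF X] by simp
    qed
  qed
qed

lemma sq_norm_weight_mono:
  assumes "spin_system I A m" "\<And>X. X \<in> states \<Longrightarrow> w X \<le> K * m X"
  shows "sq_norm f \<le> K * spin_system.weighted_inner I A m f f"
proof -
  interpret m: spin_system I A m by fact
  have "w X * (f X * f X) \<le> (K * m X) * (f X * f X)" if "X \<in> states" for X
    using assms(2)[OF that] by (rule mult_right_mono) simp
  then show ?thesis
    unfolding weighted_inner_def m.weighted_inner_def sum_distrib_left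
    by (intro sum_mono) (simp add: mult.assoc)
qed

lemma cond_variance_le_sum_site_variances:
  assumes B: "B \<subseteq> I" and "0 \<le> K"
    and K: "\<And>X Y. X \<in> states \<Longrightarrow> Y \<in> fibre B X \<Longrightarrow> w X \<le> K * w Y"
  shows "cond_variance B f \<le> K * (\<Sum>v\<in>B. cond_variance {v} f)"
proof -
  obtain m where m: "spin_system I A m" "invariant B m"
      "\<And>X. X \<in> states \<Longrightarrow> m X \<le> w X" "\<And>X. X \<in> states \<Longrightarrow> w X \<le> K * m X"
    using invariant_minorant[OF K] by blast
  interpret m: spin_system I A m by fact
  obtain h where h: "invariant B h"
      "m.sq_norm (\<lambda>X. f X - h X) \<le> (\<Sum>v\<in>B. m.cond_variance {v} f)"
    using m.invariant_approximation[OF B m(2)] by blast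
  have "cond_variance B f \<le> sq_norm (\<lambda>X. f X - h X)"
    by (rule cond_exp_best_approximation[OF h(1)])
  also have "\<dots> \<le> K * m.sq_norm (\<lambda>X. f X - h X)"
    by (rule sq_norm_weight_mono[OF m(1,4)])
  also have "\<dots> \<le> K * (\<Sum>v\<in>B. cond_variance {v} f)"
  proof (intro mult_left_mono order_trans[OF h(2)] sum_mono)
    fix v
    have "m.cond_variance {v} f \<le> m.sq_norm (\<lambda>X. f X - cond_exp {v} f X)"
      by (intro m.cond_exp_best_approximation cond_exp_invariant)
    also have "\<dots> \<le> 1 * sq_norm (\<lambda>X. f X - cond_exp {v} f X)"
      by (rule m.sq_norm_weight_mono[OF spin_system_axioms]) (simp add: m(3))
    finally show "m.cond_variance {v} f \<le> cond_variance {v} f"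
      by (simp add: cond_variance_def)
  qed fact
  finally show ?thesis .
qed

end

section \<open>Block dynamics\<close>

context spin_system
begin

definition total_weight :: real where
  "total_weight = (\<Sum>X\<in>states. w X)"

definition mean :: "(('i \<Rightarrow> 'a) \<Rightarrow> real) \<Rightarrow> real" where
  "mean f = (\<Sum>X\<in>states. w X * f X) / total_weight"

definition block_avg ::
  "'p set \<Rightarrow> ('p \<Rightarrow> 'i set) \<Rightarrow> (('i \<Rightarrow> 'a) \<Rightarrow> real) \<Rightarrow> ('i \<Rightarrow> 'a) \<Rightarrow> real" where
  "block_avg J B f X = (\<Sum>p\<in>J. cond_exp (B p) f X) / real (card J)"

lemma total_weight_pos: "X \<in> states \<Longrightarrow> 0 < total_weight"
  using sum_fibre_pos[of X I] by (simp add: total_weight_def fibre_all_sites)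

lemma mean_eq_cond_exp: "X \<in> states \<Longrightarrow> mean f = cond_exp I f X"
  by (simp add: mean_def cond_exp_def total_weight_def fibre_all_sites)

lemma mean_eq_inner: "mean f = \<langle>f, \<lambda>_. 1\<rangle> / total_weight"
  by (simp add: mean_def weighted_inner_def)

lemma mean_diff_const: "X \<in> states \<Longrightarrow> mean (\<lambda>Y. f Y - b) = mean f - b"
  using total_weight_pos[of X]
  by (simp add: mean_def right_diff_distrib sum_subtractf diff_divide_distrib
      flip: sum_distrib_right total_weight_def)

lemma abs_cond_exp_le:
  assumes "X \<in> states" "\<And>Y. Y \<in> fibre B X \<Longrightarrow> \<bar>f Y\<bar> \<le> b"
  shows "\<bar>cond_exp B f X\<bar> \<le> b"
proof -
  have Z: "0 < (\<Sum>Y\<in>fibre B X. w Y)" by (rule sum_fibre_pos[OF assms(1)])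
  have "\<bar>\<Sum>Y\<in>fibre B X. w Y * f Y\<bar> \<le> (\<Sum>Y\<in>fibre B X. w Y * b)"
  proof (intro order_trans[OF sum_abs] sum_mono)
    fix Y assume "Y \<in> fibre B X"
    then show "\<bar>w Y * f Y\<bar> \<le> w Y * b"
      using assms(2)[of Y] weight_pos[of Y] by (simp add: abs_mult fibre_in_states)
  qed
  also have "\<dots> = b * (\<Sum>Y\<in>fibre B X. w Y)" by (simp add: sum_distrib_left mult.commute)
  finally show ?thesis using Z by (simp add: cond_exp_def abs_divide divide_le_eq)
qed

lemma site_lipschitz_cond_exp_deviation:
  assumes f: "site_lipschitz f l" and X: "X \<in> states" and B: "B \<subseteq> I"
  shows "\<bar>f X - cond_exp B f X\<bar> \<le> real (card B) * l"
proof -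
  have "f X - cond_exp B f X = cond_exp B (\<lambda>Y. f X - f Y) X"
    using cond_exp_of_invariant[of B "\<lambda>_. f X" X] X by (simp add: cond_exp_diff invariant_def)
  also have "\<bar>\<dots>\<bar> \<le> real (card B) * l"
    by (intro abs_cond_exp_le X site_lipschitz_on_fibre[OF f X B])
  finally show ?thesis .
qed

lemma site_lipschitz_mean_deviation:
  assumes "site_lipschitz f l" "X \<in> states"
  shows "\<bar>f X - mean f\<bar> \<le> real (card I) * l"
  using site_lipschitz_cond_exp_deviation[OF assms order_refl] mean_eq_cond_exp[OF assms(2)] by simp

lemma sq_norm_le_of_bounded:
  assumes "\<And>X. X \<in> states \<Longrightarrow> \<bar>f X\<bar> \<le> b"
  shows "sq_norm f \<le> b\<^sup>2 * total_weight"
  unfolding weighted_inner_def total_weight_def sum_distrib_left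
proof (rule sum_mono)
  fix X assume X: "X \<in> states"
  have "(f X)\<^sup>2 \<le> b\<^sup>2" using assms[OF X] by (metis abs_ge_zero power2_abs power_mono)
  then show "w X * f X * f X \<le> b\<^sup>2 * w X"
    using weight_pos[OF X] by (simp add: power2_eq_square mult_ac)
qed

lemma sq_norm_centred_le:
  "sq_norm (\<lambda>X. f X - mean f) \<le> sq_norm f"
proof -
  have "sq_norm (\<lambda>X. f X - mean f) = cond_variance I f"
    unfolding cond_variance_def by (intro inner_cong) (simp_all add: mean_eq_cond_exp)
  then show ?thesis using cond_variance_le_sq_norm by simp
qed

lemma inner_block_avg: "\<langle>f, block_avg J B g\<rangle> = (\<Sum>p\<in>J. \<langle>f, cond_exp (B p) g\<rangle>) / real (card J)"
proof -
  have "\<langle>f, block_avg J B g\<rangle> = (\<Sum>X\<in>states. \<Sum>p\<in>J. w X * f X * cond_exp (B p) g X) / real (card J)"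
    by (simp add: weighted_inner_def block_avg_def sum_distrib_left sum_divide_distrib)
  also have "(\<Sum>X\<in>states. \<Sum>p\<in>J. w X * f X * cond_exp (B p) g X) = (\<Sum>p\<in>J. \<langle>f, cond_exp (B p) g\<rangle>)"
    unfolding weighted_inner_def by (rule sum.swap)
  finally show ?thesis .
qed

lemma sum_cond_variance_eq:
  assumes "finite J" "J \<noteq> {}"
  shows "(\<Sum>p\<in>J. cond_variance (B p) f) = real (card J) * (sq_norm f - \<langle>f, block_avg J B f\<rangle>)"
  using assms by (simp add: cond_variance_eq sum_subtractf inner_block_avg right_diff_distrib)

lemma block_avg_self_adjoint: "\<langle>block_avg J B f, g\<rangle> = \<langle>f, block_avg J B g\<rangle>"
proof -
  have "\<langle>g, cond_exp (B p) f\<rangle> = \<langle>f, cond_exp (B p) g\<rangle>" for p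
    using cond_exp_self_adjoint[of "B p" f g] by (simp add: inner_commute)
  then show ?thesis unfolding inner_commute[of "block_avg J B f"] inner_block_avg by simp
qed

lemma block_avg_cong: "(\<And>X. X \<in> states \<Longrightarrow> f X = g X) \<Longrightarrow> block_avg J B f X = block_avg J B g X"
  by (simp add: block_avg_def cong: cond_exp_cong)

lemma block_avg_sum:
  "block_avg J B (\<lambda>Z. \<Sum>y\<in>S. g y Z * a y) X = (\<Sum>y\<in>S. block_avg J B (g y) X * a y)"
proof -
  have "(\<Sum>p\<in>J. \<Sum>y\<in>S. cond_exp (B p) (g y) X * a y) = (\<Sum>y\<in>S. (\<Sum>p\<in>J. cond_exp (B p) (g y) X) * a y)"
    by (simp add: sum_distrib_right sum.swap[of _ J])
  then show ?thesis by (simp add: block_avg_def cond_exp_sum sum_divide_distrib[of _ S])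
qed

end

locale block_dynamics = spin_system I A w
  for I :: "'i set" and A :: "'a set" and w :: "('i \<Rightarrow> 'a) \<Rightarrow> real" +
  fixes J :: "'p set" and B :: "'p \<Rightarrow> 'i set"
  assumes finite_blocks: "finite J" and blocks_nonempty: "J \<noteq> {}"
begin

abbreviation update :: "(('i \<Rightarrow> 'a) \<Rightarrow> real) \<Rightarrow> ('i \<Rightarrow> 'a) \<Rightarrow> real" where
  "update \<equiv> block_avg J B"

lemma card_blocks_pos: "0 < card J"
  using finite_blocks blocks_nonempty by (simp add: card_gt_0_iff)

lemma update_one: "X \<in> states \<Longrightarrow> update (\<lambda>_. 1) X = 1"
  using card_blocks_pos cond_exp_of_invariant[of _ "\<lambda>_. 1" X]
  by (simp add: block_avg_def invariant_def)

lemma mean_update: "mean (update f) = mean f"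
proof -
  have "\<langle>update f, \<lambda>_. 1\<rangle> = \<langle>f, \<lambda>_. 1\<rangle>"
    unfolding block_avg_self_adjoint by (intro inner_cong refl) (rule update_one)
  then show ?thesis by (simp add: mean_eq_inner)
qed

lemma mean_funpow_update: "mean ((update ^^ t) f) = mean f"
  by (induction t) (simp_all add: mean_update)

lemma sq_norm_update_le: "sq_norm (update f) \<le> \<langle>f, update f\<rangle>"
proof -
  let ?E = "\<lambda>p. cond_exp (B p) f" and ?n = "real (card J)"
  have sum_inner: "(\<Sum>p\<in>J. \<langle>g, ?E p\<rangle>) = ?n * \<langle>g, update f\<rangle>" for g
    using card_blocks_pos by (simp add: inner_block_avg[of g])
  have "sq_norm (\<lambda>X. ?E p X - update f X)
      = \<langle>f, ?E p\<rangle> - 2 * \<langle>update f, ?E p\<rangle> + sq_norm (update f)" for p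
    by (simp add: inner_diff_left inner_diff_right inner_cond_exp_cond_exp
        inner_commute[of "?E p" "update f"])
  then have "(\<Sum>p\<in>J. sq_norm (\<lambda>X. ?E p X - update f X)) = ?n * (\<langle>f, update f\<rangle> - sq_norm (update f))"
    by (simp add: sum.distrib sum_subtractf sum_inner right_diff_distrib flip: sum_distrib_left)
  moreover have "0 \<le> (\<Sum>p\<in>J. sq_norm (\<lambda>X. ?E p X - update f X))"
    by (intro sum_nonneg sq_norm_nonneg)
  ultimately show ?thesis using card_blocks_pos by (simp add: zero_le_mult_iff)
qed

lemma sq_norm_funpow_update_le:
  assumes "0 \<le> \<rho>" and gap: "\<And>f. mean f = 0 \<Longrightarrow> \<langle>f, update f\<rangle> \<le> \<rho> * sq_norm f"
    and f: "mean f = 0"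
  shows "sq_norm ((update ^^ t) f) \<le> \<rho> ^ t * sq_norm f"
proof (induction t)
  case (Suc t)
  have "sq_norm ((update ^^ Suc t) f) \<le> \<rho> * sq_norm ((update ^^ t) f)"
    using sq_norm_update_le[of "(update ^^ t) f"] gap[of "(update ^^ t) f"] f
    by (simp add: mean_funpow_update)
  also have "\<dots> \<le> \<rho> * (\<rho> ^ t * sq_norm f)"
    using Suc \<open>0 \<le> \<rho>\<close> by (rule mult_left_mono)
  finally show ?case by simp
qed simp

lemma site_lipschitz_funpow_update:
  assumes "\<And>f l. site_lipschitz f l \<Longrightarrow> site_lipschitz (update f) (\<rho> * l)" "site_lipschitz f l"
  shows "site_lipschitz ((update ^^ t) f) (\<rho> ^ t * l)"
  by (induction t) (use assms in \<open>simp_all add: mult.assoc\<close>)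

lemma site_lipschitz_updateI:
  assumes f: "site_lipschitz f l"
    and sensitivity: "\<And>v X Y p. v \<in> I \<Longrightarrow> X \<in> states \<Longrightarrow> Y \<in> fibre {v} X \<Longrightarrow> p \<in> J \<Longrightarrow>
      \<bar>cond_exp (B p) f X - cond_exp (B p) f Y\<bar> \<le> l * s v p"
    and total: "\<And>v. v \<in> I \<Longrightarrow> (\<Sum>p\<in>J. s v p) \<le> \<rho> * real (card J)"
  shows "site_lipschitz (update f) (\<rho> * l)"
  unfolding site_lipschitz_def
proof (intro ballI)
  fix v X Y assume v: "v \<in> I" and X: "X \<in> states" and Y: "Y \<in> fibre {v} X"
  have "\<bar>update f X - update f Y\<bar>
      = \<bar>\<Sum>p\<in>J. cond_exp (B p) f X - cond_exp (B p) f Y\<bar> / real (card J)"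
    by (simp add: block_avg_def sum_subtractf flip: diff_divide_distrib)
  also have "\<dots> \<le> (\<Sum>p\<in>J. l * s v p) / real (card J)"
    by (intro divide_right_mono order_trans[OF sum_abs] sum_mono sensitivity v X Y) auto
  also have "\<dots> = l * (\<Sum>p\<in>J. s v p) / real (card J)"
    by (simp add: sum_distrib_left)
  also have "\<dots> \<le> l * (\<rho> * real (card J)) / real (card J)"
    using total[OF v] site_lipschitz_nonneg[OF f v X]
    by (intro divide_right_mono mult_left_mono) auto
  also have "\<dots> = \<rho> * l" using card_blocks_pos by simp
  finally show "\<bar>update f X - update f Y\<bar> \<le> \<rho> * l" .
qed

end

section \<open>Lipschitz contraction and spectral gap\<close>

lemma le_of_power_le_const_power:
  fixes x y c C :: real
  assumes "\<And>t. y ^ t * c \<le> C * x ^ t" "0 < c" "0 \<le> x"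
  shows "y \<le> x"
proof (rule ccontr)
  assume "\<not> y \<le> x"
  then have y: "x < y" "0 < y" using assms(3) by auto
  show False
  proof (cases "x = 0")
    case True
    then show False using assms(1)[of 1] assms(2) y by (simp add: mult_le_0_iff)
  next
    case False
    then have x: "0 < x" using assms(3) by simp
    obtain t where "C / c < (y / x) ^ t"
      using real_arch_pow[of "y / x" "C / c"] x y by auto
    then have "C * x ^ t < y ^ t * c"
      using x assms(2) by (simp add: power_divide field_simps)
    then show False using assms(1)[of t] by simp
  qed
qed

lemma log_convex_first_ratio_le:
  fixes a :: "nat \<Rightarrow> real"
  assumes nonneg: "\<And>t. 0 \<le> a t"
    and log_convex: "\<And>t. (a (Suc t))\<^sup>2 \<le> a t * a (Suc (Suc t))"
  shows "a 1 * a t \<le> a 0 * a (Suc t)"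
proof (induction t)
  case (Suc t)
  show ?case
  proof (cases "a t = 0")
    case True
    then show ?thesis using log_convex[of t] nonneg[of 0] nonneg[of "Suc (Suc t)"] by simp
  next
    case False
    have "a t * (a 1 * a (Suc t)) \<le> (a 0 * a (Suc t)) * a (Suc t)"
      using mult_right_mono[OF Suc nonneg[of "Suc t"]] by (simp add: mult_ac)
    also have "\<dots> \<le> a t * (a 0 * a (Suc (Suc t)))"
      using mult_left_mono[OF log_convex[of t] nonneg[of 0]] by (simp add: power2_eq_square mult_ac)
    finally show ?thesis using False nonneg[of t] by simp
  qed
qed (simp add: mult.commute)

lemma log_convex_ratio_le_growth_rate:
  fixes a :: "nat \<Rightarrow> real"
  assumes nonneg: "\<And>t. 0 \<le> a t"
    and log_convex: "\<And>t. (a (Suc t))\<^sup>2 \<le> a t * a (Suc (Suc t))"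
    and growth: "\<And>t. a t \<le> C * s ^ t" and s: "0 \<le> s"
  shows "a 1 \<le> s * a 0"
proof (cases "a 0 = 0")
  case True
  then show ?thesis using log_convex[of 0] by simp
next
  case False
  then have pos: "0 < a 0" using nonneg[of 0] by simp
  have "a 1 ^ t * a 0 \<le> a 0 ^ t * a t" for t
  proof (induction t)
    case (Suc t)
    have "a 1 ^ Suc t * a 0 \<le> a 0 ^ t * (a 1 * a t)"
      using mult_left_mono[OF Suc nonneg[of 1]] by (simp add: mult_ac)
    also have "\<dots> \<le> a 0 ^ t * (a 0 * a (Suc t))"
      using log_convex_first_ratio_le[of a, OF nonneg log_convex] nonneg
      by (intro mult_left_mono) auto
    finally show ?case by (simp add: mult_ac)
  qed simp
  also have "a 0 ^ t * a t \<le> C * (s * a 0) ^ t" for t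
    using mult_left_mono[OF growth[of t], of "a 0 ^ t"] pos
    by (simp add: power_mult_distrib mult_ac)
  finally show ?thesis
    by (rule le_of_power_le_const_power) (use pos s in simp_all)
qed

context block_dynamics
begin

lemma contraction_imp_gap:
  assumes "0 \<le> \<rho>"
    and contraction: "\<And>f l. site_lipschitz f l \<Longrightarrow> site_lipschitz (update f) (\<rho> * l)"
    and f: "mean f = 0"
  shows "\<langle>f, update f\<rangle> \<le> \<rho> * sq_norm f"
proof -
  define F where "F t = (update ^^ t) f" for t
  have F_Suc: "F (Suc t) = update (F t)" for t by (simp add: F_def)
  obtain l where l: "site_lipschitz f l" using site_lipschitz_exists by blast
  have "sq_norm (F 1) \<le> \<rho>\<^sup>2 * sq_norm (F 0)"
  proof (rule log_convex_ratio_le_growth_rate)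
    show "0 \<le> sq_norm (F t)" for t by (rule sq_norm_nonneg)
    show "(sq_norm (F (Suc t)))\<^sup>2 \<le> sq_norm (F t) * sq_norm (F (Suc (Suc t)))" for t
      using inner_Cauchy_Schwarz[of "F t" "F (Suc (Suc t))"]
      by (simp add: F_Suc block_avg_self_adjoint)
    show "sq_norm (F t) \<le> ((real (card I) * l)\<^sup>2 * total_weight) * (\<rho>\<^sup>2) ^ t" for t
    proof -
      have "\<bar>F t X\<bar> \<le> real (card I) * (\<rho> ^ t * l)" if "X \<in> states" for X
        unfolding F_def
        using site_lipschitz_mean_deviation[OF site_lipschitz_funpow_update[OF contraction l] that] f
        by (simp add: mean_funpow_update)
      then have "sq_norm (F t) \<le> (real (card I) * (\<rho> ^ t * l))\<^sup>2 * total_weight"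
        by (rule sq_norm_le_of_bounded)
      then show ?thesis by (simp add: power_mult_distrib mult_ac flip: power_mult)
    qed
  qed simp
  then have "sq_norm f * sq_norm (update f) \<le> sq_norm f * (\<rho>\<^sup>2 * sq_norm f)"
    by (intro mult_left_mono sq_norm_nonneg) (simp add: F_def)
  with inner_Cauchy_Schwarz[of f "update f"]
  have "\<langle>f, update f\<rangle>\<^sup>2 \<le> (\<rho> * sq_norm f)\<^sup>2"
    by (simp add: power2_eq_square mult_ac)
  then show ?thesis
    by (rule power2_le_imp_le) (simp add: \<open>0 \<le> \<rho>\<close> sq_norm_nonneg)
qed

lemma block_gap_imp_site_gap:
  assumes I: "I \<noteq> {}" and B: "\<And>p. p \<in> J \<Longrightarrow> B p \<subseteq> I"
    and d: "\<And>v. v \<in> I \<Longrightarrow> card {p \<in> J. v \<in> B p} = d" "0 < d" and "0 < K"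
    and K: "\<And>p X Y. p \<in> J \<Longrightarrow> X \<in> states \<Longrightarrow> Y \<in> fibre (B p) X \<Longrightarrow> w X \<le> K * w Y"
    and gap: "\<langle>f, update f\<rangle> \<le> (1 - \<kappa> * real d / real (card J)) * sq_norm f"
  shows "\<langle>f, block_avg I (\<lambda>v. {v}) f\<rangle> \<le> (1 - \<kappa> / (K * real (card I))) * sq_norm f"
proof -
  let ?defect = "sq_norm f - \<langle>f, block_avg I (\<lambda>v. {v}) f\<rangle>"
  have pos: "0 < real (card I)" "0 < real (card J)"
    using I finite_sites card_blocks_pos by (simp_all add: card_gt_0_iff)
  have "real d * (\<kappa> * sq_norm f) = real (card J) * (\<kappa> * real d / real (card J) * sq_norm f)"
    using pos by simp
  also have "\<dots> \<le> real (card J) * (sq_norm f - \<langle>f, update f\<rangle>)"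
    using gap by (intro mult_left_mono) (simp_all add: left_diff_distrib)
  also have "\<dots> = (\<Sum>p\<in>J. cond_variance (B p) f)"
    using finite_blocks blocks_nonempty by (simp add: sum_cond_variance_eq)
  also have "\<dots> \<le> (\<Sum>p\<in>J. K * (\<Sum>v\<in>B p. cond_variance {v} f))"
    using \<open>0 < K\<close> by (intro sum_mono cond_variance_le_sum_site_variances B K) auto
  also have "\<dots> = K * (\<Sum>p\<in>J. \<Sum>v | v \<in> I \<and> v \<in> B p. cond_variance {v} f)"
    unfolding sum_distrib_left[symmetric]
    by (intro arg_cong[where f = "times K"] sum.cong refl) (use B in blast)+
  also have "\<dots> = K * (\<Sum>v\<in>I. \<Sum>p | p \<in> J \<and> v \<in> B p. cond_variance {v} f)"
    by (simp only: sum.swap_restrict[OF finite_blocks finite_sites])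
  also have "\<dots> = K * (real d * (real (card I) * ?defect))"
    using sum_cond_variance_eq[OF finite_sites I, of "\<lambda>v. {v}" f]
    by (simp add: d flip: sum_distrib_left)
  also have "\<dots> = real d * (K * real (card I) * ?defect)" by simp
  finally have "\<kappa> * sq_norm f \<le> (K * real (card I)) * ?defect"
    by (rule mult_left_le_imp_le) (simp add: d(2))
  then have "\<kappa> * sq_norm f / (K * real (card I)) \<le> ?defect"
    using pos \<open>0 < K\<close> by (simp add: pos_divide_le_eq mult_ac)
  then show ?thesis by (simp add: left_diff_distrib)
qed

end

section \<open>Distance to equilibrium\<close>

lemma one_minus_power_le_exp:
  fixes x :: real
  assumes "x \<le> 1"
  shows "(1 - x) ^ t \<le> exp (- (x * real t))"
proof -
  have "(1 - x) ^ t \<le> exp (- x) ^ t"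
    using assms exp_ge_add_one_self[of "- x"] by (intro power_mono) auto
  also have "\<dots> = exp (- (x * real t))" by (simp add: mult.commute flip: exp_of_nat_mult)
  finally show ?thesis .
qed

context block_dynamics
begin

definition kernel :: "nat \<Rightarrow> ('i \<Rightarrow> 'a) \<Rightarrow> ('i \<Rightarrow> 'a) \<Rightarrow> real" where
  "kernel t X Y = (update ^^ t) (\<lambda>Z. of_bool (Z = Y)) X"

definition tv_to_equilibrium :: "nat \<Rightarrow> ('i \<Rightarrow> 'a) \<Rightarrow> real" where
  "tv_to_equilibrium t X = (\<Sum>Y\<in>states. \<bar>kernel t X Y - w Y / total_weight\<bar>) / 2"

lemma funpow_update_eq_sum_kernel:
  assumes "X \<in> states"
  shows "(update ^^ t) f X = (\<Sum>Y\<in>states. kernel t X Y * f Y)"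
  using assms
proof (induction t arbitrary: X)
  case 0
  have "(\<Sum>Y\<in>states. kernel 0 X Y * f Y) = (\<Sum>Y\<in>states. if X = Y then f Y else 0)"
    by (intro sum.cong) (auto simp: kernel_def)
  then show ?case using 0 by simp
next
  case (Suc t)
  have "(update ^^ Suc t) f X = update (\<lambda>Z. \<Sum>Y\<in>states. kernel t Z Y * f Y) X"
    using Suc.IH by (auto intro: block_avg_cong)
  also have "\<dots> = (\<Sum>Y\<in>states. update (\<lambda>Z. kernel t Z Y) X * f Y)"
    by (rule block_avg_sum)
  finally show ?case by (simp add: kernel_def)
qed

lemma sum_kernel:
  assumes "X \<in> states"
  shows "(\<Sum>Y\<in>states. kernel t X Y) = 1"
proof -
  have "(update ^^ t) (\<lambda>_. 1) X = 1"
    using assms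
  proof (induction t arbitrary: X)
    case (Suc t)
    then have "(update ^^ Suc t) (\<lambda>_. 1) X = update (\<lambda>_. 1) X"
      by (auto intro: block_avg_cong)
    then show ?case using Suc.prems by (simp add: update_one)
  qed simp
  then show ?thesis by (simp add: funpow_update_eq_sum_kernel[OF assms])
qed

text \<open>The sign of \<open>P\<^sup>t(X, \<cdot>) - \<pi>\<close>, recentred, turns the total variation distance into a value of
  an iterate of the update operator.\<close>

lemma tv_to_equilibrium_as_iterate:
  assumes X: "X \<in> states"
  obtains g where "mean g = 0" "site_lipschitz g 2" "sq_norm g \<le> total_weight"
    "2 * tv_to_equilibrium t X = (update ^^ t) g X"
proof
  define s where "s Y = sgn (kernel t X Y - w Y / total_weight)" for Y
  have s_bounded: "\<bar>s Y\<bar> \<le> 1" for Y by (simp add: s_def sgn_if)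
  show "mean (\<lambda>Y. s Y - mean s) = 0"
    by (simp add: mean_diff_const[OF X])
  show "site_lipschitz (\<lambda>Y. s Y - mean s) 2"
    unfolding site_lipschitz_def
  proof (intro ballI)
    show "\<bar>(s Y - mean s) - (s Z - mean s)\<bar> \<le> 2" for Y Z
      using s_bounded[of Y] s_bounded[of Z] by linarith
  qed
  show "sq_norm (\<lambda>Y. s Y - mean s) \<le> total_weight"
    using sq_norm_centred_le[of s] sq_norm_le_of_bounded[of s 1] s_bounded by simp
  have "2 * tv_to_equilibrium t X = (\<Sum>Y\<in>states. (kernel t X Y - w Y / total_weight) * s Y)"
    by (simp add: tv_to_equilibrium_def s_def abs_sgn)
  also have "\<dots> = (\<Sum>Y\<in>states. kernel t X Y * s Y) - mean s"
    by (simp add: mean_def left_diff_distrib sum_subtractf sum_divide_distrib)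
  also have "\<dots> = (\<Sum>Y\<in>states. kernel t X Y * (s Y - mean s))"
    using sum_kernel[OF X] by (simp add: right_diff_distrib sum_subtractf flip: sum_distrib_right)
  also have "\<dots> = (update ^^ t) (\<lambda>Y. s Y - mean s) X"
    by (rule funpow_update_eq_sum_kernel[OF X, symmetric])
  finally show "2 * tv_to_equilibrium t X = (update ^^ t) (\<lambda>Y. s Y - mean s) X" .
qed

lemma tv_le_of_contraction:
  assumes X: "X \<in> states" and \<epsilon>: "0 < \<epsilon>" and "I \<noteq> {}" "\<delta> \<le> 1"
    and contraction: "\<And>f l. site_lipschitz f l \<Longrightarrow> site_lipschitz (update f) ((1 - \<delta>) * l)"
    and t: "ln (real (card I)) + ln (1 / \<epsilon>) \<le> \<delta> * real t"
  shows "tv_to_equilibrium t X \<le> \<epsilon>"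
proof -
  have n: "0 < real (card I)" using \<open>I \<noteq> {}\<close> finite_sites by (simp add: card_gt_0_iff)
  obtain g where g: "mean g = 0" "site_lipschitz g 2"
      "2 * tv_to_equilibrium t X = (update ^^ t) g X"
    using tv_to_equilibrium_as_iterate[OF X] by metis
  have "\<bar>(update ^^ t) g X\<bar> \<le> real (card I) * ((1 - \<delta>) ^ t * 2)"
    using site_lipschitz_mean_deviation[OF site_lipschitz_funpow_update[OF contraction g(2)] X] g(1)
    by (simp add: mean_funpow_update)
  then have "tv_to_equilibrium t X \<le> real (card I) * (1 - \<delta>) ^ t"
    using g(3) by simp
  also have "\<dots> \<le> real (card I) * exp (- (\<delta> * real t))"
    using n by (intro mult_left_mono one_minus_power_le_exp \<open>\<delta> \<le> 1\<close>) simp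
  also have "\<dots> \<le> real (card I) * exp (- (ln (real (card I)) + ln (1 / \<epsilon>)))"
    using t n by (intro mult_left_mono) simp_all
  also have "\<dots> = \<epsilon>"
    using n \<epsilon> by (simp add: exp_diff ln_div)
  finally show ?thesis .
qed

lemma tv_le_of_gap:
  assumes X: "X \<in> states" and \<epsilon>: "0 < \<epsilon>" and "\<gamma> \<le> 1"
    and gap: "\<And>f. mean f = 0 \<Longrightarrow> \<langle>f, update f\<rangle> \<le> (1 - \<gamma>) * sq_norm f"
    and t: "ln (total_weight / w X) + 2 * ln (1 / \<epsilon>) \<le> \<gamma> * real t"
  shows "tv_to_equilibrium t X \<le> \<epsilon>"
proof -
  have wX: "0 < w X" by (rule weight_pos[OF X])
  obtain g where g: "mean g = 0" "sq_norm g \<le> total_weight"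
      "2 * tv_to_equilibrium t X = (update ^^ t) g X"
    using tv_to_equilibrium_as_iterate[OF X] by metis
  let ?h = "(update ^^ t) g"
  have "w X * (?h X)\<^sup>2 = w X * ?h X * ?h X" by (simp add: power2_eq_square)
  also have "\<dots> \<le> sq_norm ?h"
    unfolding weighted_inner_def
    using X weighted_square_nonneg
    by (intro member_le_sum[of X states "\<lambda>Y. w Y * ?h Y * ?h Y"]) auto
  also have "\<dots> \<le> (1 - \<gamma>) ^ t * sq_norm g"
    using \<open>\<gamma> \<le> 1\<close> by (intro sq_norm_funpow_update_le gap g) simp_all
  also have "\<dots> \<le> exp (- (\<gamma> * real t)) * total_weight"
    using \<open>\<gamma> \<le> 1\<close> sq_norm_nonneg by (intro mult_mono one_minus_power_le_exp g) simp_all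
  finally have "(?h X)\<^sup>2 \<le> exp (- (\<gamma> * real t)) * (total_weight / w X)"
    using wX by (simp add: pos_le_divide_eq mult_ac)
  also have "\<dots> = exp (ln (total_weight / w X) - \<gamma> * real t)"
    using wX total_weight_pos[OF X] by (simp add: exp_diff exp_minus field_simps)
  also have "\<dots> \<le> exp (2 * ln \<epsilon>)"
    using t \<epsilon> by (simp add: ln_div)
  also have "\<dots> = \<epsilon>\<^sup>2"
    using \<epsilon> exp_of_nat_mult[of 2 "ln \<epsilon>"] by simp
  finally have "2 * tv_to_equilibrium t X \<le> \<epsilon>"
    unfolding g(3) by (rule power2_le_imp_le) (use \<epsilon> in simp)
  then show ?thesis using \<epsilon> by linarith
qed

end

section \<open>Changing one boundary spin\<close>

lemma sum_abs_diff_le_of_proportional: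
  fixes p p' :: "'b \<Rightarrow> real"
  assumes C: "finite C" and nonneg: "\<And>s. s \<in> C \<Longrightarrow> 0 \<le> p s" "\<And>s. s \<in> C \<Longrightarrow> 0 \<le> p' s"
    and sum_1: "(\<Sum>s\<in>C. p s) = 1" "(\<Sum>s\<in>C. p' s) = 1"
    and proportional: "\<And>s. s \<in> C \<Longrightarrow> s \<notin> Bad \<Longrightarrow> p' s = \<alpha> * p s"
    and bad: "(\<Sum>s\<in>C \<inter> Bad. p s) \<le> \<delta>" "(\<Sum>s\<in>C \<inter> Bad. p' s) \<le> \<delta>"
  shows "(\<Sum>s\<in>C. \<bar>p s - p' s\<bar>) \<le> 2 * \<delta>"
proof -
  let ?good = "\<lambda>h. \<Sum>s\<in>C - Bad. h s" and ?bad = "\<lambda>h. \<Sum>s\<in>C \<inter> Bad. h s"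
  have split: "(\<Sum>s\<in>C. h s) = ?bad h + ?good h" for h :: "'b \<Rightarrow> real"
    using sum.Int_Diff[OF C] .
  have "?good (\<lambda>s. \<bar>p s - p' s\<bar>) = ?good (\<lambda>s. \<bar>1 - \<alpha>\<bar> * p s)"
  proof (rule sum.cong[OF refl])
    fix s assume s: "s \<in> C - Bad"
    have "p s - p' s = (1 - \<alpha>) * p s" using s by (simp add: proportional left_diff_distrib)
    then show "\<bar>p s - p' s\<bar> = \<bar>1 - \<alpha>\<bar> * p s" using s nonneg(1) by (simp add: abs_mult)
  qed
  also have "\<dots> = \<bar>1 - \<alpha>\<bar> * \<bar>?good p\<bar>"
    using nonneg(1) by (subst abs_of_nonneg) (auto intro: sum_nonneg simp: sum_distrib_left)
  also have "\<dots> = \<bar>?good p - ?good p'\<bar>"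
    by (simp add: proportional left_diff_distrib flip: abs_mult sum_distrib_left)
  also have "\<dots> = \<bar>?bad p' - ?bad p\<bar>"
    using split[of p] split[of p'] sum_1 by simp
  finally have good: "?good (\<lambda>s. \<bar>p s - p' s\<bar>) = \<bar>?bad p' - ?bad p\<bar>" .
  have "?bad (\<lambda>s. \<bar>p s - p' s\<bar>) \<le> ?bad (\<lambda>s. p s + p' s)"
  proof (rule sum_mono)
    show "\<bar>p s - p' s\<bar> \<le> p s + p' s" if "s \<in> C \<inter> Bad" for s
      using that nonneg[of s] by auto
  qed
  then show ?thesis
    using split[of "\<lambda>s. \<bar>p s - p' s\<bar>"] good bad by (simp add: sum.distrib)
qed

lemma abs_diff_expectation_le:
  fixes p p' f g :: "'b \<Rightarrow> real"
  assumes nonneg: "\<And>s. s \<in> C \<Longrightarrow> 0 \<le> p s"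
    and sum_1: "(\<Sum>s\<in>C. p s) = 1" "(\<Sum>s\<in>C. p' s) = 1"
    and close: "\<And>s. s \<in> C \<Longrightarrow> \<bar>f s - g s\<bar> \<le> a" and range: "\<And>s. s \<in> C \<Longrightarrow> \<bar>g s - m\<bar> \<le> b"
  shows "\<bar>(\<Sum>s\<in>C. p s * f s) - (\<Sum>s\<in>C. p' s * g s)\<bar> \<le> a + (\<Sum>s\<in>C. \<bar>p s - p' s\<bar>) * b"
proof -
  have "(\<Sum>s\<in>C. p s * f s) - (\<Sum>s\<in>C. p' s * g s)
      = (\<Sum>s\<in>C. p s * (f s - g s)) + (\<Sum>s\<in>C. (p s - p' s) * (g s - m))"
  proof -
    have "(\<Sum>s\<in>C. (p s - p' s) * m) = 0"
      using sum_1 by (simp add: sum_subtractf flip: sum_distrib_right)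
    then show ?thesis by (simp add: left_diff_distrib right_diff_distrib sum_subtractf)
  qed
  also have "\<bar>\<dots>\<bar> \<le> (\<Sum>s\<in>C. p s * a) + (\<Sum>s\<in>C. \<bar>p s - p' s\<bar> * b)"
  proof (intro order_trans[OF abs_triangle_ineq] add_mono order_trans[OF sum_abs] sum_mono)
    fix s assume s: "s \<in> C"
    show "\<bar>p s * (f s - g s)\<bar> \<le> p s * a"
      using nonneg[OF s] close[OF s] by (simp add: abs_mult mult_left_mono)
    show "\<bar>(p s - p' s) * (g s - m)\<bar> \<le> \<bar>p s - p' s\<bar> * b"
      using range[OF s] by (simp add: abs_mult mult_left_mono)
  qed
  finally show ?thesis using sum_1 by (simp flip: sum_distrib_right)
qed

context spin_system
begin

definition cond_dist :: "'i set \<Rightarrow> ('i \<Rightarrow> 'a) \<Rightarrow> ('i \<Rightarrow> 'a) \<Rightarrow> real" where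
  "cond_dist B X s = w s / (\<Sum>Y\<in>fibre B X. w Y)"

definition cond_prob :: "'i set \<Rightarrow> ('i \<Rightarrow> 'a) \<Rightarrow> ('i \<Rightarrow> 'a) set \<Rightarrow> real" where
  "cond_prob B X E = cond_exp B (\<lambda>s. of_bool (s \<in> E)) X"

lemma cond_dist_nonneg: "X \<in> states \<Longrightarrow> s \<in> states \<Longrightarrow> 0 \<le> cond_dist B X s"
  using weight_pos[of s] sum_fibre_pos[of X B] by (simp add: cond_dist_def)

lemma sum_cond_dist: "X \<in> states \<Longrightarrow> (\<Sum>s\<in>fibre B X. cond_dist B X s) = 1"
  using sum_fibre_pos[of X B] by (simp add: cond_dist_def flip: sum_divide_distrib)

lemma cond_exp_eq_sum: "cond_exp B f X = (\<Sum>s\<in>fibre B X. cond_dist B X s * f s)"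
  by (simp add: cond_exp_def cond_dist_def sum_divide_distrib)

lemma cond_prob_eq_sum: "cond_prob B X E = (\<Sum>s\<in>fibre B X \<inter> E. cond_dist B X s)"
  by (simp add: cond_prob_def cond_exp_eq_sum)

lemma cond_prob_le_sum:
  assumes X: "X \<in> states" and "finite K" and cover: "\<And>s. s \<in> fibre B X \<Longrightarrow> s \<in> E \<Longrightarrow> \<exists>k\<in>K. s \<in> F k"
  shows "cond_prob B X E \<le> (\<Sum>k\<in>K. cond_prob B X (F k))"
proof -
  have "of_bool (s \<in> E) \<le> (\<Sum>k\<in>K. of_bool (s \<in> F k) :: real)" if s: "s \<in> fibre B X" for s
  proof (cases "s \<in> E")
    case True
    then obtain k where "k \<in> K" "s \<in> F k" using cover[OF s] by blast
    then show ?thesis using \<open>finite K\<close> member_le_sum[of k K "\<lambda>k. of_bool (s \<in> F k) :: real"] by simp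
  qed (simp add: sum_nonneg)
  then have "cond_prob B X E \<le> (\<Sum>s\<in>fibre B X. cond_dist B X s * (\<Sum>k\<in>K. of_bool (s \<in> F k)))"
    unfolding cond_prob_def cond_exp_eq_sum
    by (intro sum_mono mult_left_mono cond_dist_nonneg X fibre_in_states) auto
  also have "\<dots> = (\<Sum>k\<in>K. cond_prob B X (F k))"
    unfolding cond_prob_def cond_exp_eq_sum sum_distrib_left by (rule sum.swap)
  finally show ?thesis .
qed

lemma cond_exp_inside_change:
  assumes "v \<in> B" "Y \<in> fibre {v} X"
  shows "cond_exp B f Y = cond_exp B f X"
proof -
  have "Y \<in> fibre B X" using assms fibre_mono[of "{v}" B X] by blast
  then show ?thesis by (simp add: cond_exp_def fibre_eq)
qed

lemma sum_abs_cond_dist_diff_le: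
  assumes v: "v \<in> I" "v \<notin> B" and X: "X \<in> states" and Y: "Y \<in> fibre {v} X"
    and good: "\<And>s. s \<in> fibre B X \<Longrightarrow> s \<notin> Bad \<Longrightarrow> w (s(v := Y v)) = a * w s"
    and Bad_upd: "\<And>s. s(v := Y v) \<in> Bad \<longleftrightarrow> s \<in> Bad"
    and bad: "cond_prob B X Bad \<le> \<delta>" "cond_prob B Y Bad \<le> \<delta>"
  shows "(\<Sum>s\<in>fibre B X. \<bar>cond_dist B X s - cond_dist B Y (s(v := Y v))\<bar>) \<le> 2 * \<delta>"
proof (rule sum_abs_diff_le_of_proportional[where Bad = Bad])
  let ?C = "fibre B X" and ?\<phi> = "\<lambda>s. s(v := Y v)"
  have Y_state: "Y \<in> states" using Y by (rule fibre_in_states)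
  have bij: "bij_betw ?\<phi> ?C (fibre B Y)" by (rule fibre_boundary_change[OF v X Y])
  show "0 \<le> cond_dist B X s" "0 \<le> cond_dist B Y (?\<phi> s)" if "s \<in> ?C" for s
    using that bij_betwE[OF bij] by (intro cond_dist_nonneg X Y_state fibre_in_states; blast)+
  show "(\<Sum>s\<in>?C. cond_dist B X s) = 1" by (rule sum_cond_dist[OF X])
  show "(\<Sum>s\<in>?C. cond_dist B Y (?\<phi> s)) = 1"
    unfolding sum.reindex_bij_betw[OF bij] by (rule sum_cond_dist[OF Y_state])
  show "cond_dist B Y (?\<phi> s) = a * (\<Sum>s\<in>?C. w s) / (\<Sum>s\<in>fibre B Y. w s) * cond_dist B X s"
    if "s \<in> ?C" "s \<notin> Bad" for s
    using good[OF that] sum_fibre_pos[OF X, of B] by (simp add: cond_dist_def)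
  show "(\<Sum>s\<in>?C \<inter> Bad. cond_dist B X s) \<le> \<delta>" using bad(1) by (simp add: cond_prob_eq_sum)
  have "cond_prob B Y Bad = (\<Sum>s\<in>?C. cond_dist B Y (?\<phi> s) * of_bool (?\<phi> s \<in> Bad))"
    unfolding cond_prob_def cond_exp_eq_sum by (rule sum.reindex_bij_betw[OF bij, symmetric])
  then show "(\<Sum>s\<in>?C \<inter> Bad. cond_dist B Y (?\<phi> s)) \<le> \<delta>" using bad(2) by (simp add: Bad_upd)
qed simp

lemma cond_exp_boundary_change:
  assumes f: "site_lipschitz f l" and v: "v \<in> I" "v \<notin> B" and B: "B \<subseteq> I"
    and X: "X \<in> states" and Y: "Y \<in> fibre {v} X"
  shows "\<bar>cond_exp B f X - cond_exp B f Y\<bar>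
    \<le> l * (1 + (\<Sum>s\<in>fibre B X. \<bar>cond_dist B X s - cond_dist B Y (s(v := Y v))\<bar>) * real (card B))"
proof -
  let ?C = "fibre B X" and ?\<phi> = "\<lambda>s. s(v := Y v)"
  let ?p = "cond_dist B X" and ?p' = "\<lambda>s. cond_dist B Y (?\<phi> s)"
  have Y_state: "Y \<in> states" using Y by (rule fibre_in_states)
  have bij: "bij_betw ?\<phi> ?C (fibre B Y)" by (rule fibre_boundary_change[OF v X Y])
  have \<phi>: "?\<phi> s \<in> fibre B Y" if "s \<in> ?C" for s using bij_betwE[OF bij] that by blast
  have "cond_exp B f Y = (\<Sum>s\<in>?C. ?p' s * f (?\<phi> s))"
    unfolding cond_exp_eq_sum by (rule sum.reindex_bij_betw[OF bij, symmetric])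
  moreover have "\<bar>(\<Sum>s\<in>?C. ?p s * f s) - (\<Sum>s\<in>?C. ?p' s * f (?\<phi> s))\<bar>
      \<le> l + (\<Sum>s\<in>?C. \<bar>?p s - ?p' s\<bar>) * (real (card B) * l)"
  proof (rule abs_diff_expectation_le)
    show "(\<Sum>s\<in>?C. ?p s) = 1" by (rule sum_cond_dist[OF X])
    show "(\<Sum>s\<in>?C. ?p' s) = 1"
      unfolding sum.reindex_bij_betw[OF bij] by (rule sum_cond_dist[OF Y_state])
    fix s assume s: "s \<in> ?C"
    show "0 \<le> ?p s" by (intro cond_dist_nonneg X fibre_in_states[OF s])
    have "?\<phi> s \<in> fibre {v} s" using fibre_in_states[OF \<phi>[OF s]] by (simp add: fibre_def)
    then show "\<bar>f s - f (?\<phi> s)\<bar> \<le> l"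
      using f v(1) fibre_in_states[OF s] by (simp add: site_lipschitz_def)
    show "\<bar>f (?\<phi> s) - f Y\<bar> \<le> real (card B) * l"
      using site_lipschitz_on_fibre[OF f Y_state B \<phi>[OF s]] by (simp add: abs_minus_commute)
  qed
  ultimately show ?thesis
    by (simp add: cond_exp_eq_sum[of B f X] algebra_simps)
qed

end

section \<open>The Potts model on a graph of bounded degree\<close>

locale potts_model =
  fixes V :: "'v set" and E :: "'v set set" and \<Delta> q :: nat and lam :: real
  assumes finite_V: "finite V" and V_nonempty: "V \<noteq> {}"
    and edge_endpoints: "\<And>e. e \<in> E \<Longrightarrow> \<exists>u\<in>V. \<exists>v\<in>V. u \<noteq> v \<and> e = {u, v}"
    and degree_le: "\<And>v. v \<in> V \<Longrightarrow> card {u. {v, u} \<in> E} \<le> \<Delta>" and degree_pos: "0 < \<Delta>"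
    and lam_ge_1: "1 \<le> lam" and q_pos: "0 < q"
begin

definition neighbours :: "'v \<Rightarrow> 'v set" where
  "neighbours v = {u. {v, u} \<in> E}"

definition monochromatic_edges :: "('v \<Rightarrow> nat) \<Rightarrow> 'v set set" where
  "monochromatic_edges \<sigma> = {e \<in> E. \<exists>c. \<forall>u\<in>e. \<sigma> u = c}"

definition monochromatic_edges_meeting :: "'v set \<Rightarrow> ('v \<Rightarrow> nat) \<Rightarrow> 'v set set" where
  "monochromatic_edges_meeting S \<sigma> = {e \<in> monochromatic_edges \<sigma>. e \<inter> S \<noteq> {}}"

definition weight :: "('v \<Rightarrow> nat) \<Rightarrow> real" where
  "weight \<sigma> = lam ^ card (monochromatic_edges \<sigma>)"

definition colour_class :: "'v set \<Rightarrow> nat \<Rightarrow> ('v \<Rightarrow> nat) \<Rightarrow> 'v set" where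
  "colour_class B c \<sigma> = {u \<in> B. \<sigma> u = c}"

definition colour_sparse :: "real \<Rightarrow> 'v set \<Rightarrow> bool" where
  "colour_sparse \<theta> B \<longleftrightarrow> (\<forall>\<sigma> c.
    real (card (monochromatic_edges_meeting (colour_class B c \<sigma>) \<sigma>))
      \<le> \<theta> * real (card (colour_class B c \<sigma>)))"

definition colour_rate :: "real \<Rightarrow> real" where
  "colour_rate \<theta> = lam powr \<theta> / real q"

lemma weight_ge_1: "1 \<le> weight \<sigma>"
  using lam_ge_1 by (simp add: weight_def)

lemma weight_positive: "0 < weight \<sigma>"
  using weight_ge_1[of \<sigma>] by linarith

sublocale spin_system V "{..<q}" weight
  by unfold_locales (simp_all add: finite_V weight_positive)

sublocale sites: block_dynamics V "{..<q}" weight V "\<lambda>v. {v}"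
  by unfold_locales (simp_all add: finite_V V_nonempty)

lemma colour_rate_pos: "0 < colour_rate \<theta>"
  using lam_ge_1 q_pos by (simp add: colour_rate_def)

lemma finite_E [simp]: "finite E"
proof (rule finite_subset)
  show "E \<subseteq> Pow V" by (auto dest: edge_endpoints)
qed (simp add: finite_V)

lemma finite_monochromatic_edges [simp]: "finite (monochromatic_edges \<sigma>)"
  by (simp add: monochromatic_edges_def)

lemma finite_monochromatic_edges_meeting [simp]: "finite (monochromatic_edges_meeting S \<sigma>)"
  by (simp add: monochromatic_edges_meeting_def)

lemma neighbours_subset: "neighbours v \<subseteq> V"
  by (auto simp: neighbours_def doubleton_eq_iff dest!: edge_endpoints)

lemma finite_neighbours: "finite (neighbours v)"
  using neighbours_subset finite_V by (rule finite_subset)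

lemma neighbours_irrefl: "v \<notin> neighbours v"
  by (auto simp: neighbours_def dest!: edge_endpoints)

lemma edges_at_eq: "{e \<in> E. v \<in> e} = (\<lambda>u. {v, u}) ` neighbours v"
proof -
  have "\<exists>u\<in>neighbours v. e = {v, u}" if "e \<in> E" "v \<in> e" for e
    using edge_endpoints[OF that(1)] that by (auto simp: neighbours_def insert_commute)
  then show ?thesis by (auto simp: neighbours_def)
qed

lemma card_monochromatic_edges_meeting_le:
  assumes "S \<subseteq> V"
  shows "card (monochromatic_edges_meeting S \<sigma>) \<le> \<Delta> * card S"
proof -
  have finS: "finite S" using assms finite_V by (rule finite_subset)
  have "monochromatic_edges_meeting S \<sigma> \<subseteq> (\<Union>v\<in>S. (\<lambda>u. {v, u}) ` neighbours v)"
    unfolding edges_at_eq[symmetric] monochromatic_edges_meeting_def monochromatic_edges_def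
    by blast
  then have "card (monochromatic_edges_meeting S \<sigma>) \<le> card (\<Union>v\<in>S. (\<lambda>u. {v, u}) ` neighbours v)"
    using finS finite_neighbours by (intro card_mono) auto
  also have "\<dots> \<le> (\<Sum>v\<in>S. card ((\<lambda>u. {v, u}) ` neighbours v))"
    by (rule card_UN_le[OF finS])
  also have "\<dots> \<le> (\<Sum>v\<in>S. \<Delta>)"
  proof (rule sum_mono)
    fix v assume "v \<in> S"
    have "card ((\<lambda>u. {v, u}) ` neighbours v) \<le> card (neighbours v)"
      by (rule card_image_le[OF finite_neighbours])
    also have "\<dots> \<le> \<Delta>" using degree_le assms \<open>v \<in> S\<close> by (auto simp: neighbours_def)
    finally show "card ((\<lambda>u. {v, u}) ` neighbours v) \<le> \<Delta>" .
  qed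
  finally show ?thesis by (simp add: mult.commute)
qed

lemma weight_le_of_agree_off:
  assumes "\<And>u. u \<notin> S \<Longrightarrow> \<sigma> u = \<tau> u"
  shows "weight \<sigma> \<le> lam ^ card (monochromatic_edges_meeting S \<sigma>) * weight \<tau>"
proof -
  let ?M = "monochromatic_edges_meeting S \<sigma>"
  have "e \<in> monochromatic_edges \<tau>" if "e \<in> monochromatic_edges \<sigma>" "e \<inter> S = {}" for e
  proof -
    have "\<forall>u\<in>e. \<sigma> u = \<tau> u" using assms that(2) by blast
    then show ?thesis using that(1) by (auto simp: monochromatic_edges_def)
  qed
  then have "monochromatic_edges \<sigma> \<subseteq> ?M \<union> monochromatic_edges \<tau>"
    by (auto simp: monochromatic_edges_meeting_def)
  then have "card (monochromatic_edges \<sigma>) \<le> card (?M \<union> monochromatic_edges \<tau>)"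
    by (intro card_mono) auto
  also have "\<dots> \<le> card ?M + card (monochromatic_edges \<tau>)" by (rule card_Un_le)
  finally show ?thesis
    unfolding weight_def power_add[symmetric] using lam_ge_1 by (rule power_increasing)
qed

lemma weight_fibre_ratio:
  assumes "B \<subseteq> V" "card B \<le> b" "Y \<in> fibre B X"
  shows "weight X \<le> lam ^ (\<Delta> * b) * weight Y"
proof -
  have "card (monochromatic_edges_meeting B X) \<le> \<Delta> * card B"
    by (rule card_monochromatic_edges_meeting_le[OF assms(1)])
  also have "\<dots> \<le> \<Delta> * b" using assms(2) by simp
  finally have "lam ^ card (monochromatic_edges_meeting B X) \<le> lam ^ (\<Delta> * b)"
    using lam_ge_1 by (rule power_increasing)
  moreover have "weight X \<le> lam ^ card (monochromatic_edges_meeting B X) * weight Y"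
    by (rule weight_le_of_agree_off) (rule fibre_outside[OF assms(3), symmetric])
  ultimately show ?thesis
    using weight_positive[of Y] by (meson less_imp_le mult_right_mono order_trans)
qed

lemma total_weight_le: "total_weight \<le> real q ^ card V * lam ^ card E"
proof -
  have "weight X \<le> lam ^ card E" for X
    unfolding weight_def monochromatic_edges_def
    using lam_ge_1 by (intro power_increasing card_mono) auto
  then have "total_weight \<le> real (card states) * lam ^ card E"
    unfolding total_weight_def by (intro sum_bounded_above)
  then show ?thesis by (simp add: states_def card_PiE finite_V)
qed

lemma weight_upd:
  "weight (X(v := c))
    = lam ^ card {e \<in> monochromatic_edges X. v \<notin> e} * lam ^ card {u \<in> neighbours v. X u = c}"
proof -
  let ?M = "monochromatic_edges (X(v := c))"
  have off: "{e \<in> ?M. v \<notin> e} = {e \<in> monochromatic_edges X. v \<notin> e}"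
  proof -
    have "(\<forall>u\<in>e. (X(v := c)) u = c') \<longleftrightarrow> (\<forall>u\<in>e. X u = c')" if "v \<notin> e" for e c'
      using that by (intro ball_cong refl) auto
    then show ?thesis unfolding monochromatic_edges_def by blast
  qed
  have "{e \<in> ?M. v \<in> e} = {e \<in> {e \<in> E. v \<in> e}. \<forall>u\<in>e. (X(v := c)) u = c}"
    by (auto simp: monochromatic_edges_def)
  also have "\<dots> = (\<lambda>u. {v, u}) ` {u \<in> neighbours v. X u = c}"
    unfolding edges_at_eq using neighbours_irrefl by auto
  finally have at: "card {e \<in> ?M. v \<in> e} = card {u \<in> neighbours v. X u = c}"
    using neighbours_irrefl by (auto intro!: card_image inj_onI simp: doubleton_eq_iff)
  have "card ?M = card ({e \<in> ?M. v \<notin> e} \<union> {e \<in> ?M. v \<in> e})"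
    by (rule arg_cong[where f = card]) blast
  also have "\<dots> = card {e \<in> ?M. v \<notin> e} + card {e \<in> ?M. v \<in> e}"
    by (rule card_Un_disjoint) auto
  finally show ?thesis by (simp add: weight_def off at power_add)
qed

lemma colour_sparse_degree:
  assumes "B \<subseteq> V"
  shows "colour_sparse (real \<Delta>) B"
proof -
  have "colour_class B c \<sigma> \<subseteq> V" for c \<sigma> using assms by (auto simp: colour_class_def)
  then show ?thesis
    unfolding colour_sparse_def of_nat_mult[symmetric] of_nat_le_iff
    by (intro allI card_monochromatic_edges_meeting_le)
qed

section \<open>Rarity of a given colour in a block\<close>

lemma weight_le_fibre_of_colour_class:
  assumes B: "B \<subseteq> V" "colour_sparse \<theta> B" and \<sigma>: "\<sigma> \<in> states"
    and S: "S = colour_class B c \<sigma>"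
  shows "weight \<sigma> \<le> colour_rate \<theta> ^ card S * (\<Sum>\<tau>\<in>fibre S \<sigma>. weight \<tau>)"
proof -
  let ?M = "monochromatic_edges_meeting S \<sigma>"
  have "weight \<sigma> \<le> (lam powr \<theta>) ^ card S * weight \<tau>" if \<tau>: "\<tau> \<in> fibre S \<sigma>" for \<tau>
  proof -
    have "weight \<sigma> \<le> lam ^ card ?M * weight \<tau>"
      by (rule weight_le_of_agree_off) (rule fibre_outside[OF \<tau>, symmetric])
    also have "lam ^ card ?M = lam powr real (card ?M)"
      using lam_ge_1 by (simp add: powr_realpow)
    also have "\<dots> \<le> lam powr (\<theta> * real (card S))"
      using B(2) lam_ge_1 unfolding colour_sparse_def S by (intro powr_mono) auto
    also have "\<dots> = (lam powr \<theta>) ^ card S"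
      using lam_ge_1 by (simp add: powr_realpow flip: powr_powr)
    finally show ?thesis using weight_positive[of \<tau>] by simp
  qed
  then have "(\<Sum>\<tau>\<in>fibre S \<sigma>. weight \<sigma>) \<le> (lam powr \<theta>) ^ card S * (\<Sum>\<tau>\<in>fibre S \<sigma>. weight \<tau>)"
    unfolding sum_distrib_left by (rule sum_mono)
  moreover have "S \<subseteq> V" using B(1) by (auto simp: S colour_class_def)
  ultimately have "real q ^ card S * weight \<sigma> \<le> (lam powr \<theta>) ^ card S * (\<Sum>\<tau>\<in>fibre S \<sigma>. weight \<tau>)"
    by (simp add: card_fibre \<sigma>)
  then show ?thesis using q_pos by (simp add: colour_rate_def power_divide field_simps)
qed

lemma colour_class_prob_le:
  assumes B: "B \<subseteq> V" "colour_sparse \<theta> B" and X: "X \<in> states" and "S \<subseteq> B"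
  shows "cond_prob B X {\<sigma>. colour_class B c \<sigma> = S} \<le> colour_rate \<theta> ^ card S"
proof -
  let ?D = "fibre B X \<inter> {\<sigma>. colour_class B c \<sigma> = S}"
  have disjoint: "fibre S \<sigma> \<inter> fibre S \<tau> = {}" if "\<sigma> \<in> ?D" "\<tau> \<in> ?D" "\<sigma> \<noteq> \<tau>" for \<sigma> \<tau>
  proof -
    obtain u where u: "\<sigma> u \<noteq> \<tau> u" using \<open>\<sigma> \<noteq> \<tau>\<close> by blast
    have "\<sigma> u = \<tau> u" if "u \<in> S"
    proof -
      have "u \<in> colour_class B c \<sigma>" "u \<in> colour_class B c \<tau>"
        using that \<open>\<sigma> \<in> ?D\<close> \<open>\<tau> \<in> ?D\<close> by auto
      then show ?thesis by (simp add: colour_class_def)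
    qed
    then have "u \<notin> S" using u by blast
    then have "\<rho> u = \<sigma> u" if "\<rho> \<in> fibre S \<sigma>" for \<rho> \<sigma> by (rule fibre_outside[OF that])
    then show ?thesis using u by (metis disjoint_iff)
  qed
  have in_block: "fibre S \<sigma> \<subseteq> fibre B X" if "\<sigma> \<in> ?D" for \<sigma>
  proof -
    have "fibre S \<sigma> \<subseteq> fibre B \<sigma>" by (rule fibre_mono[OF \<open>S \<subseteq> B\<close>])
    also have "\<dots> = fibre B X" using that by (intro fibre_eq) blast
    finally show ?thesis .
  qed
  have "(\<Sum>\<sigma>\<in>?D. weight \<sigma>) \<le> (\<Sum>\<sigma>\<in>?D. colour_rate \<theta> ^ card S * (\<Sum>\<tau>\<in>fibre S \<sigma>. weight \<tau>))"
    by (intro sum_mono weight_le_fibre_of_colour_class[OF B]) (auto dest: fibre_in_states)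
  also have "\<dots> = colour_rate \<theta> ^ card S * (\<Sum>\<tau>\<in>(\<Union>\<sigma>\<in>?D. fibre S \<sigma>). weight \<tau>)"
    using disjoint by (subst sum.UNION_disjoint) (auto simp: sum_distrib_left)
  also have "\<dots> \<le> colour_rate \<theta> ^ card S * (\<Sum>\<tau>\<in>fibre B X. weight \<tau>)"
    using in_block weight_positive colour_rate_pos[of \<theta>]
    by (intro mult_left_mono sum_mono2) (auto intro: less_imp_le)
  finally show ?thesis
    using sum_fibre_pos[OF X, of B]
    by (simp add: cond_prob_eq_sum cond_dist_def pos_divide_le_eq flip: sum_divide_distrib)
qed

lemma colour_present_prob_le:
  assumes B: "B \<subseteq> V" "colour_sparse \<theta> B" and X: "X \<in> states" and rate: "colour_rate \<theta> \<le> 1"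
  shows "cond_prob B X {\<sigma>. colour_class B c \<sigma> \<noteq> {}} \<le> 2 ^ card B * colour_rate \<theta>"
proof -
  have finB: "finite B" using B(1) finite_V by (rule finite_subset)
  have "cond_prob B X {\<sigma>. colour_class B c \<sigma> \<noteq> {}}
      \<le> (\<Sum>S\<in>Pow B - {{}}. cond_prob B X {\<sigma>. colour_class B c \<sigma> = S})"
    using finB by (intro cond_prob_le_sum X) (auto simp: colour_class_def)
  also have "\<dots> \<le> real (card (Pow B - {{}})) * colour_rate \<theta>"
  proof (rule sum_bounded_above)
    fix S assume S: "S \<in> Pow B - {{}}"
    then have "1 \<le> card S" using finB by (auto simp: Suc_le_eq card_gt_0_iff dest: finite_subset)
    have "cond_prob B X {\<sigma>. colour_class B c \<sigma> = S} \<le> colour_rate \<theta> ^ card S"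
      using S by (intro colour_class_prob_le B X) blast
    also have "\<dots> \<le> colour_rate \<theta> ^ 1"
      using \<open>1 \<le> card S\<close> rate colour_rate_pos[of \<theta>] by (intro power_decreasing) auto
    finally show "cond_prob B X {\<sigma>. colour_class B c \<sigma> = S} \<le> colour_rate \<theta>" by simp
  qed
  also have "\<dots> \<le> real (card (Pow B)) * colour_rate \<theta>"
    using finB colour_rate_pos[of \<theta>] by (intro mult_right_mono of_nat_mono card_mono) auto
  finally show ?thesis using finB by (simp add: card_Pow)
qed

section \<open>Sensitivity of a block to its boundary\<close>

definition disagreement_bound :: "real \<Rightarrow> 'v set \<Rightarrow> 'v \<Rightarrow> real" where
  "disagreement_bound \<theta> B v =
    (if neighbours v \<inter> B = {} then 0 else 2 ^ (card B + 1) * colour_rate \<theta>)"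

lemma two_colours_near_prob_le:
  assumes B: "B \<subseteq> V" "colour_sparse \<theta> B" and X: "X \<in> states" and rate: "colour_rate \<theta> \<le> 1"
  shows "cond_prob B X {s. \<exists>u\<in>neighbours v \<inter> B. s u \<in> {a, b}} \<le> disagreement_bound \<theta> B v"
proof (cases "neighbours v \<inter> B = {}")
  case True
  then show ?thesis by (simp add: cond_prob_eq_sum disagreement_bound_def)
next
  case False
  have "cond_prob B X {s. \<exists>u\<in>neighbours v \<inter> B. s u \<in> {a, b}}
      \<le> (\<Sum>c\<in>{a, b}. cond_prob B X {\<sigma>. colour_class B c \<sigma> \<noteq> {}})"
    by (intro cond_prob_le_sum X) (auto simp: colour_class_def)
  also have "\<dots> \<le> real (card {a, b}) * (2 ^ card B * colour_rate \<theta>)"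
    by (intro sum_bounded_above colour_present_prob_le B X rate)
  also have "\<dots> \<le> 2 * (2 ^ card B * colour_rate \<theta>)"
    using colour_rate_pos[of \<theta>] by (intro mult_right_mono) (auto simp: card_insert_if)
  finally show ?thesis using False by (simp add: disagreement_bound_def)
qed

lemma weight_upd_ratio:
  assumes v: "v \<notin> B" and s: "s \<in> fibre B X"
    and avoid: "\<And>u. u \<in> neighbours v \<inter> B \<Longrightarrow> s u \<notin> {X v, c}"
  shows "weight (s(v := c)) = lam ^ card {u \<in> neighbours v - B. X u = c}
      / lam ^ card {u \<in> neighbours v - B. X u = X v} * weight s"
proof -
  have outside: "{u \<in> neighbours v. s u = a} = {u \<in> neighbours v - B. X u = a}"
    if "a \<in> {X v, c}" for a
    using that avoid fibre_outside[OF s] by (intro Collect_cong) (metis DiffD1 DiffD2 DiffI IntI)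
  have "s(v := X v) = s" using fibre_outside[OF s v] by (simp add: fun_upd_idem)
  then show ?thesis
    using weight_upd[of s v "X v"] weight_upd[of s v c] lam_ge_1 by (simp add: outside)
qed

lemma cond_exp_boundary_sensitivity:
  assumes B: "B \<subseteq> V" "colour_sparse \<theta> B" and rate: "colour_rate \<theta> \<le> 1"
    and v: "v \<in> V" "v \<notin> B" and X: "X \<in> states" and Y: "Y \<in> fibre {v} X"
    and f: "site_lipschitz f l"
  shows "\<bar>cond_exp B f X - cond_exp B f Y\<bar> \<le> l * (1 + 2 * disagreement_bound \<theta> B v * real (card B))"
proof -
  let ?Bad = "{s. \<exists>u\<in>neighbours v \<inter> B. s u \<in> {X v, Y v}}"
  let ?dist = "\<Sum>s\<in>fibre B X. \<bar>cond_dist B X s - cond_dist B Y (s(v := Y v))\<bar>"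
  have "?dist \<le> 2 * disagreement_bound \<theta> B v"
  proof (rule sum_abs_cond_dist_diff_le[OF v X Y])
    show "weight (s(v := Y v)) = lam ^ card {u \<in> neighbours v - B. X u = Y v}
        / lam ^ card {u \<in> neighbours v - B. X u = X v} * weight s"
      if "s \<in> fibre B X" "s \<notin> ?Bad" for s
      using that by (intro weight_upd_ratio v) auto
    show "s(v := Y v) \<in> ?Bad \<longleftrightarrow> s \<in> ?Bad" for s
      using v(2) by auto
    show "cond_prob B X ?Bad \<le> disagreement_bound \<theta> B v"
        "cond_prob B Y ?Bad \<le> disagreement_bound \<theta> B v"
      by (rule two_colours_near_prob_le[OF B _ rate], rule X fibre_in_states[OF Y])+
  qed
  then have "l * (1 + ?dist * real (card B))
      \<le> l * (1 + 2 * disagreement_bound \<theta> B v * real (card B))"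
    using site_lipschitz_nonneg[OF f v(1) X]
    by (intro mult_left_mono add_left_mono mult_right_mono) auto
  then show ?thesis using cond_exp_boundary_change[OF f v B(1) X Y] by linarith
qed

end

section \<open>Spectral gap and mixing from a cover by sparse blocks\<close>

locale sparse_block_cover = potts_model V E \<Delta> q lam
  for V :: "'v set" and E :: "'v set set" and \<Delta> q :: nat and lam :: real +
  fixes J :: "'p set" and B :: "'p \<Rightarrow> 'v set" and b d :: nat and \<theta> :: real
  assumes finite_J: "finite J"
    and block_subset: "\<And>p. p \<in> J \<Longrightarrow> B p \<subseteq> V" and card_block_le: "\<And>p. p \<in> J \<Longrightarrow> card (B p) \<le> b"
    and cover: "\<And>v. v \<in> V \<Longrightarrow> card {p \<in> J. v \<in> B p} = d" and cover_pos: "0 < d"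
    and block_sparse: "\<And>p. p \<in> J \<Longrightarrow> colour_sparse \<theta> (B p)"
    and many_colours: "4 * real \<Delta> * real b * 2 ^ (b + 1) * colour_rate \<theta> \<le> 1"
begin

lemma exists_block:
  assumes "v \<in> V"
  obtains p where "p \<in> J" "v \<in> B p"
proof -
  have "{p \<in> J. v \<in> B p} \<noteq> {}"
    using cover[OF assms] cover_pos by (metis card.empty less_irrefl)
  then show thesis using that by blast
qed

sublocale blocks: block_dynamics V "{..<q}" weight J B
  by unfold_locales (use finite_J V_nonempty in \<open>auto elim: exists_block\<close>)

lemma block_size_pos: "0 < b"
proof -
  obtain v where "v \<in> V" using V_nonempty by blast
  then obtain p where p: "p \<in> J" "v \<in> B p" by (rule exists_block)
  moreover have "finite (B p)" using block_subset[OF p(1)] finite_V by (rule finite_subset)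
  ultimately have "0 < card (B p)" by (auto simp: card_gt_0_iff)
  also have "\<dots> \<le> b" by (rule card_block_le[OF p(1)])
  finally show ?thesis .
qed

lemma colour_rate_le_1: "colour_rate \<theta> \<le> 1"
proof -
  have "1 * 1 * 1 \<le> real \<Delta> * real b * 2 ^ (b + 1)"
    using degree_pos block_size_pos by (intro mult_mono one_le_power) simp_all
  then have "1 * colour_rate \<theta> \<le> (4 * real \<Delta> * real b * 2 ^ (b + 1)) * colour_rate \<theta>"
    using colour_rate_pos[of \<theta>] by (intro mult_right_mono) linarith+
  then show ?thesis using many_colours by simp
qed

lemma card_adjacent_blocks_le:
  assumes "v \<in> V"
  shows "card {p \<in> J. neighbours v \<inter> B p \<noteq> {}} \<le> \<Delta> * d"
proof -
  have "card {p \<in> J. neighbours v \<inter> B p \<noteq> {}} \<le> card (\<Union>u\<in>neighbours v. {p \<in> J. u \<in> B p})"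
    using finite_neighbours finite_J by (intro card_mono) auto
  also have "\<dots> \<le> (\<Sum>u\<in>neighbours v. card {p \<in> J. u \<in> B p})"
    by (rule card_UN_le[OF finite_neighbours])
  also have "\<dots> = card (neighbours v) * d"
    using neighbours_subset[of v] by (simp add: cover subset_iff)
  also have "\<dots> \<le> \<Delta> * d"
    using degree_le[OF assms] by (intro mult_right_mono) (simp_all add: neighbours_def)
  finally show ?thesis .
qed

definition sensitivity :: "'v \<Rightarrow> 'p \<Rightarrow> real" where
  "sensitivity v p = (if v \<in> B p then 0 else 1)
    + (if neighbours v \<inter> B p = {} then 0 else 2 * (2 ^ (b + 1) * colour_rate \<theta>) * real b)"

lemma cond_exp_block_sensitivity:
  assumes v: "v \<in> V" and X: "X \<in> states" and Y: "Y \<in> fibre {v} X" and p: "p \<in> J"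
    and f: "site_lipschitz f l"
  shows "\<bar>cond_exp (B p) f X - cond_exp (B p) f Y\<bar> \<le> l * sensitivity v p"
proof (cases "v \<in> B p")
  case True
  have "0 \<le> l * sensitivity v p"
    using site_lipschitz_nonneg[OF f v X] colour_rate_pos[of \<theta>] by (simp add: sensitivity_def)
  then show ?thesis using cond_exp_inside_change[OF True Y] by simp
next
  case False
  have l: "0 \<le> l" by (rule site_lipschitz_nonneg[OF f v X])
  have "2 ^ (card (B p) + 1) * colour_rate \<theta> * real (card (B p))
      \<le> 2 ^ (b + 1) * colour_rate \<theta> * real b"
    using card_block_le[OF p] colour_rate_pos[of \<theta>]
    by (intro mult_mono mult_right_mono power_increasing) auto
  then have "1 + 2 * disagreement_bound \<theta> (B p) v * real (card (B p)) \<le> sensitivity v p"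
    using False by (simp add: disagreement_bound_def sensitivity_def)
  then have "l * (1 + 2 * disagreement_bound \<theta> (B p) v * real (card (B p))) \<le> l * sensitivity v p"
    using l by (rule mult_left_mono)
  then show ?thesis
    using cond_exp_boundary_sensitivity
      [OF block_subset[OF p] block_sparse[OF p] colour_rate_le_1 v False X Y f]
    by linarith
qed

lemma sum_sensitivity_le:
  assumes v: "v \<in> V"
  shows "(\<Sum>p\<in>J. sensitivity v p) \<le> real (card J) - real d / 2"
proof -
  let ?s = "2 * (2 ^ (b + 1) * colour_rate \<theta>) * real b"
  have "(\<Sum>p\<in>J. if v \<in> B p then 0 else 1 :: real) = (\<Sum>p\<in>J. 1 - (if v \<in> B p then 1 else 0))"
    by (intro sum.cong) auto
  also have "\<dots> = real (card J) - real d"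
    using finite_J by (simp add: sum_subtractf cover[OF v] flip: sum.inter_filter)
  finally have inside: "(\<Sum>p\<in>J. if v \<in> B p then 0 else 1) = real (card J) - real d" .
  have "(\<Sum>p\<in>J. if neighbours v \<inter> B p = {} then 0 else ?s)
      = (\<Sum>p\<in>J. if neighbours v \<inter> B p \<noteq> {} then ?s else 0)"
    by (intro sum.cong) auto
  also have "\<dots> = real (card {p \<in> J. neighbours v \<inter> B p \<noteq> {}}) * ?s"
    using finite_J by (simp flip: sum.inter_filter)
  also have "\<dots> \<le> (real \<Delta> * real d) * ?s"
    using card_adjacent_blocks_le[OF v] colour_rate_pos[of \<theta>]
    by (intro mult_right_mono) (simp_all flip: of_nat_mult)
  also have "\<dots> = (4 * real \<Delta> * real b * 2 ^ (b + 1) * colour_rate \<theta>) * (real d / 2)" by simp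
  also have "\<dots> \<le> real d / 2"
    using mult_right_mono[OF many_colours, of "real d / 2"] by simp
  finally show ?thesis unfolding sensitivity_def sum.distrib inside by linarith
qed

theorem block_contraction:
  assumes "site_lipschitz f l"
  shows "site_lipschitz (blocks.update f) ((1 - 1 / 2 * real d / real (card J)) * l)"
proof (rule blocks.site_lipschitz_updateI[OF assms])
  show "\<bar>cond_exp (B p) f X - cond_exp (B p) f Y\<bar> \<le> l * sensitivity v p"
    if "v \<in> V" "X \<in> states" "Y \<in> fibre {v} X" "p \<in> J" for v X Y p
    using that assms by (rule cond_exp_block_sensitivity)
  show "(\<Sum>p\<in>J. sensitivity v p) \<le> (1 - 1 / 2 * real d / real (card J)) * real (card J)"
    if "v \<in> V" for v
    using sum_sensitivity_le[OF that] blocks.card_blocks_pos by (simp add: left_diff_distrib)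
qed

lemma cover_le_card: "d \<le> card J"
proof -
  obtain v where "v \<in> V" using V_nonempty by blast
  have "card {p \<in> J. v \<in> B p} \<le> card J" using finite_J by (intro card_mono) auto
  then show ?thesis by (simp add: cover[OF \<open>v \<in> V\<close>])
qed

theorem site_gap:
  assumes "mean f = 0"
  shows "weighted_inner f (sites.update f)
    \<le> (1 - 1 / 2 / (lam ^ (\<Delta> * b) * real (card V))) * sq_norm f"
proof (rule blocks.block_gap_imp_site_gap)
  show "weighted_inner f (blocks.update f) \<le> (1 - 1 / 2 * real d / real (card J)) * sq_norm f"
  proof (rule blocks.contraction_imp_gap[OF _ block_contraction assms])
    show "0 \<le> 1 - 1 / 2 * real d / real (card J)"
      using cover_le_card blocks.card_blocks_pos by (simp add: divide_le_eq)
  qed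
  show "weight X \<le> lam ^ (\<Delta> * b) * weight Y" if "p \<in> J" "Y \<in> fibre (B p) X" for p X Y
    by (rule weight_fibre_ratio[OF block_subset[OF that(1)] card_block_le[OF that(1)] that(2)])
qed (use V_nonempty block_subset cover cover_pos lam_ge_1 in simp_all)

theorem sites_tv_le:
  assumes X: "X \<in> states" and \<epsilon>: "0 < \<epsilon>"
    and t: "2 * lam ^ (\<Delta> * b) * real (card V)
      * (ln (real q ^ card V * lam ^ card E) + 2 * ln (1 / \<epsilon>)) \<le> real t"
  shows "sites.tv_to_equilibrium t X \<le> \<epsilon>"
proof (rule sites.tv_le_of_gap[OF X \<epsilon> _ site_gap])
  let ?\<gamma> = "1 / 2 / (lam ^ (\<Delta> * b) * real (card V))"
  have n: "1 \<le> real (card V)" using sites.card_blocks_pos by simp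
  have K: "1 \<le> lam ^ (\<Delta> * b)" using lam_ge_1 by simp
  have Kn: "1 \<le> lam ^ (\<Delta> * b) * real (card V)" using mult_mono[OF K n] n K by simp
  then show "?\<gamma> \<le> 1" by (simp add: divide_le_eq)
  have "total_weight / weight X \<le> total_weight / 1"
    using weight_ge_1[of X] total_weight_pos[OF X] by (intro divide_left_mono) auto
  then have "total_weight / weight X \<le> real q ^ card V * lam ^ card E"
    using total_weight_le by simp
  then have "ln (total_weight / weight X) \<le> ln (real q ^ card V * lam ^ card E)"
    using weight_positive total_weight_pos[OF X] by (intro ln_mono) (auto intro: divide_pos_pos)
  moreover have "ln (real q ^ card V * lam ^ card E) + 2 * ln (1 / \<epsilon>) \<le> ?\<gamma> * real t"
    using t Kn by (simp add: field_simps)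
  ultimately show "ln (total_weight / weight X) + 2 * ln (1 / \<epsilon>) \<le> ?\<gamma> * real t" by linarith
qed

end

context potts_model
begin

lemma single_site_cover:
  assumes "16 * real \<Delta> * lam ^ \<Delta> \<le> real q"
  shows "sparse_block_cover V E \<Delta> q lam V (\<lambda>v. {v}) 1 1 (real \<Delta>)"
proof
  show "card {u \<in> V. v \<in> {u}} = 1" if "v \<in> V" for v
  proof -
    have "{u \<in> V. v \<in> {u}} = {v}" using that by blast
    then show ?thesis by simp
  qed
  show "4 * real \<Delta> * real 1 * 2 ^ (1 + 1) * colour_rate (real \<Delta>) \<le> 1"
    using assms lam_ge_1 q_pos by (simp add: colour_rate_def powr_realpow divide_le_eq)
qed (use colour_sparse_degree in \<open>simp_all add: finite_V\<close>)

theorem sites_tv_le_of_many_colours: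
  assumes q: "16 * real \<Delta> * lam ^ \<Delta> \<le> real q" and X: "X \<in> states" and \<epsilon>: "0 < \<epsilon>"
    and t: "2 * real (card V) * (ln (real (card V)) + ln (1 / \<epsilon>)) \<le> real t"
  shows "sites.tv_to_equilibrium t X \<le> \<epsilon>"
proof (rule sites.tv_le_of_contraction[OF X \<epsilon> V_nonempty, where \<delta> = "1 / 2 / real (card V)"])
  have n: "0 < card V" by (rule sites.card_blocks_pos)
  then show "1 / 2 / real (card V) \<le> 1" by (simp add: divide_le_eq)
  interpret single: sparse_block_cover V E \<Delta> q lam V "\<lambda>v. {v}" 1 1 "real \<Delta>"
    by (rule single_site_cover[OF q])
  show "site_lipschitz (sites.update f) ((1 - 1 / 2 / real (card V)) * l)"
    if "site_lipschitz f l" for f l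
    using single.block_contraction[OF that] by simp
  show "ln (real (card V)) + ln (1 / \<epsilon>) \<le> 1 / 2 / real (card V) * real t"
    using t n by (simp add: field_simps)
qed

end

section \<open>Steps along a row\<close>

definition steps_meeting_avoiding :: "'v set \<Rightarrow> ('v \<Rightarrow> 'v) \<Rightarrow> 'v set \<Rightarrow> 'v set \<Rightarrow> 'v set" where
  "steps_meeting_avoiding V R S T = {u \<in> V. {u, R u} \<inter> S \<noteq> {} \<and> {u, R u} \<inter> T = {}}"

lemma finite_steps_meeting_avoiding [simp]: "finite V \<Longrightarrow> finite (steps_meeting_avoiding V R S T)"
  by (simp add: steps_meeting_avoiding_def)

lemma row_steps_subset:
  assumes R: "inj_on R V" "\<And>k. R (e k) = e (Suc k)"
    and row: "e ` {..<r} \<subseteq> V" and S: "S \<subseteq> e ` {..<r}"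
  shows "steps_meeting_avoiding V R S (e ` {..<r} - S)
    \<subseteq> {u \<in> S. R u \<notin> e ` {..<r} - S} \<union> {u \<in> V. R u = e 0 \<and> e 0 \<in> S}"
proof
  fix u assume u: "u \<in> steps_meeting_avoiding V R S (e ` {..<r} - S)"
  show "u \<in> {u \<in> S. R u \<notin> e ` {..<r} - S} \<union> {u \<in> V. R u = e 0 \<and> e 0 \<in> S}"
  proof (cases "u \<in> S")
    case True
    then show ?thesis using u by (auto simp: steps_meeting_avoiding_def)
  next
    case False
    then have u_outside: "u \<notin> e ` {..<r}" "R u \<in> S" "u \<in> V"
      using u by (auto simp: steps_meeting_avoiding_def)
    then obtain k where k: "k < r" "R u = e k" using S by auto
    have "k = 0"
    proof (cases k)
      case (Suc j)
      then have "e j \<in> e ` {..<r}" "R u = R (e j)" using k R(2) by auto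
      then have "u = e j" using R(1) row u_outside(3) by (auto dest: inj_onD)
      then show ?thesis using u_outside(1) \<open>e j \<in> e ` {..<r}\<close> by simp
    qed simp
    then show ?thesis using k u_outside by simp
  qed
qed

lemma exists_step_leaving:
  assumes "\<And>k. R (e k) = e (Suc k)" "e 0 \<in> S" "S \<subset> e ` {..<r}"
  shows "\<exists>u\<in>S. R u \<in> e ` {..<r} - S"
proof -
  obtain m where m: "m < r" "e m \<notin> S" using assms(3) by auto
  then obtain k where "k < m" "e k \<in> S" "e (Suc k) \<notin> S"
    using ex_least_nat_less[of "\<lambda>k. e k \<notin> S" m] assms(2) by blast
  then show ?thesis using assms(1) m(1) by (intro bexI[of _ "e k"]) auto
qed

text \<open>Apart from the step that enters the row at its start, every step can be charged to its source
  in \<open>S\<close>. If \<open>S\<close> does not fill the row, the entering step is compensated by a step from \<open>S\<close> to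
  the rest of the row.\<close>

lemma card_row_steps_le:
  assumes V: "finite V" and R: "inj_on R V" "\<And>k. R (e k) = e (Suc k)"
    and row: "inj_on e {..<r}" "e ` {..<r} \<subseteq> V" and S: "S \<subseteq> e ` {..<r}"
  shows "r * card (steps_meeting_avoiding V R S (e ` {..<r} - S)) \<le> (r + 1) * card S"
proof -
  let ?steps = "steps_meeting_avoiding V R S (e ` {..<r} - S)"
  let ?kept = "{u \<in> S. R u \<notin> e ` {..<r} - S}" and ?entry = "{u \<in> V. R u = e 0 \<and> e 0 \<in> S}"
  have finS: "finite S" using S by (rule finite_subset) simp
  have "card ?steps \<le> card (?kept \<union> ?entry)"
    using finS V by (intro card_mono row_steps_subset R row S) auto
  also have "\<dots> \<le> card ?kept + card ?entry" by (rule card_Un_le)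
  finally have steps: "card ?steps \<le> card ?kept + card ?entry" .
  have kept: "card ?kept \<le> card S" using finS by (intro card_mono) auto
  have "card ?entry \<le> card {e 0}"
    by (rule card_inj_on_le[of R]) (auto intro: inj_on_subset[OF R(1)])
  then have entry: "card ?entry \<le> 1" by simp
  consider (full) "S = e ` {..<r}" | (no_entry) "e 0 \<notin> S" | (partial) "e 0 \<in> S" "S \<subset> e ` {..<r}"
    using S by blast
  then show ?thesis
  proof cases
    case full
    have card_S: "card S = r" unfolding full using row(1) by (simp add: card_image)
    then have "card ?steps \<le> r + 1" using steps kept entry by linarith
    then show ?thesis by (simp only: card_S mult.commute[of "r + 1"] mult_le_mono2)
  next
    case no_entry
    then have "card ?steps \<le> card S" using steps kept by simp
    then show ?thesis by (simp add: trans_le_add2 mult_le_mono)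
  next
    case partial
    have "card ?kept < card S"
      using exists_step_leaving[OF R(2) partial] finS by (intro psubset_card_mono) auto
    then have "card ?steps \<le> card S" using steps entry by linarith
    then show ?thesis by (simp add: trans_le_add2 mult_le_mono)
  qed
qed

lemma card_strip_steps_le:
  fixes R :: "'v \<Rightarrow> 'v" and e :: "'j \<Rightarrow> nat \<Rightarrow> 'v"
  assumes V: "finite V" "inj_on R V" and J: "finite J"
    and strip: "inj_on (\<lambda>(j, k). e j k) (J \<times> {..<r})"
      "(\<lambda>(j, k). e j k) ` (J \<times> {..<r}) = B" "B \<subseteq> V"
    and R: "\<And>j k. R (e j k) = e j (Suc k)" and S: "S \<subseteq> B"
  shows "r * card (steps_meeting_avoiding V R S (B - S)) \<le> (r + 1) * card S"
proof -
  define row where "row j = e j ` {..<r}" for j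
  let ?H = "\<lambda>j. steps_meeting_avoiding V R (S \<inter> row j) (row j - S \<inter> row j)"
  have finS: "finite S" using S strip(3) V(1) by (meson finite_subset)
  have B: "B = (\<Union>j\<in>J. row j)" using strip(2) by (auto simp: row_def)
  have inj_row: "inj_on (e j) {..<r}" if "j \<in> J" for j
    using strip(1) that by (auto simp: inj_on_def)
  have disjoint: "row i \<inter> row j = {}" if "i \<in> J" "j \<in> J" "i \<noteq> j" for i j
    using strip(1) that by (auto simp: row_def inj_on_def)
  have "steps_meeting_avoiding V R S (B - S) \<subseteq> (\<Union>j\<in>J. ?H j)"
    using S unfolding B by (auto simp: steps_meeting_avoiding_def)
  then have "card (steps_meeting_avoiding V R S (B - S)) \<le> card (\<Union>j\<in>J. ?H j)"
    using J V by (intro card_mono) auto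
  also have "\<dots> \<le> (\<Sum>j\<in>J. card (?H j))" by (rule card_UN_le[OF J])
  finally have "r * card (steps_meeting_avoiding V R S (B - S)) \<le> (\<Sum>j\<in>J. r * card (?H j))"
    by (simp flip: sum_distrib_left)
  also have "\<dots> \<le> (\<Sum>j\<in>J. (r + 1) * card (S \<inter> row j))"
    unfolding row_def
    by (intro sum_mono card_row_steps_le V R inj_row) (use strip(3) B in \<open>auto simp: row_def\<close>)
  also have "\<dots> = (r + 1) * (\<Sum>j\<in>J. card (S \<inter> row j))" by (rule sum_distrib_left[symmetric])
  also have "(\<Sum>j\<in>J. card (S \<inter> row j)) = card (\<Union>j\<in>J. S \<inter> row j)"
    using J finS disjoint by (intro card_UN_disjoint[symmetric]) auto
  also have "(\<Union>j\<in>J. S \<inter> row j) = S" using S B by blast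
  finally show ?thesis .
qed

section \<open>Blocks of the torus\<close>

definition translate :: "nat \<Rightarrow> nat \<times> nat \<Rightarrow> nat \<times> nat \<Rightarrow> nat \<times> nat" where
  "translate L k u = ((fst u + fst k) mod L, (snd u + snd k) mod L)"

abbreviation east :: "nat \<Rightarrow> nat \<times> nat \<Rightarrow> nat \<times> nat" where
  "east L \<equiv> translate L (1, 0)"

abbreviation north :: "nat \<Rightarrow> nat \<times> nat \<Rightarrow> nat \<times> nat" where
  "north L \<equiv> translate L (0, 1)"

definition block :: "nat \<Rightarrow> nat \<Rightarrow> nat \<times> nat \<Rightarrow> (nat \<times> nat) set" where
  "block L r p = (\<lambda>k. translate L k p) ` ({..<r} \<times> {..<r})"

lemma finite_torus_V [simp]: "finite (torus_V L)"
  by (simp add: torus_V_def)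

lemma card_torus_V: "card (torus_V L) = L\<^sup>2"
  by (simp add: torus_V_def power2_eq_square)

lemma torus_V_nonempty: "0 < L \<Longrightarrow> torus_V L \<noteq> {}"
  by (auto simp: torus_V_def)

lemma translate_in_torus_V: "0 < L \<Longrightarrow> translate L k u \<in> torus_V L"
  by (simp add: translate_def torus_V_def)

lemma translate_translate:
  "translate L k (translate L j u) = translate L (fst j + fst k, snd j + snd k) u"
  by (simp add: translate_def mod_add_left_eq add.assoc)

lemma add_mod_right_cancel:
  fixes a b k L :: nat
  assumes "a < L" "b < L" "(a + k) mod L = (b + k) mod L"
  shows "a = b"
  using assms cong_add_rcancel_nat[of a k b L] by (simp add: cong_def)

lemma inj_on_translate: "inj_on (translate L k) (torus_V L)"
  by (rule inj_onI) (auto simp: translate_def torus_V_def dest: add_mod_right_cancel)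

lemma inj_on_translate_offset: "inj_on (\<lambda>k. translate L k p) ({..<L} \<times> {..<L})"
proof (rule inj_onI)
  fix j k assume "j \<in> {..<L} \<times> {..<L}" "k \<in> {..<L} \<times> {..<L}"
    and eq: "translate L j p = translate L k p"
  then have "fst j < L" "fst k < L" "snd j < L" "snd k < L" by auto
  moreover have "(fst j + fst p) mod L = (fst k + fst p) mod L"
      "(snd j + snd p) mod L = (snd k + snd p) mod L"
    using eq by (simp_all add: translate_def add.commute)
  ultimately show "j = k" by (intro prod_eqI; blast intro: add_mod_right_cancel)
qed

lemma bij_betw_translate: "0 < L \<Longrightarrow> bij_betw (translate L k) (torus_V L) (torus_V L)"
  by (intro bij_betw_imageI inj_on_translate endo_inj_surj) (auto intro: translate_in_torus_V)

lemma block_subset_torus_V: "0 < L \<Longrightarrow> block L r p \<subseteq> torus_V L"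
  by (auto simp: block_def intro: translate_in_torus_V)

lemma card_block_le_square: "card (block L r p) \<le> r\<^sup>2"
  using card_image_le[of "{..<r} \<times> {..<r}" "\<lambda>k. translate L k p"]
  by (simp add: block_def power2_eq_square)

lemma card_blocks_containing:
  assumes v: "v \<in> torus_V L" and r: "r \<le> L"
  shows "card {p \<in> torus_V L. v \<in> block L r p} = r\<^sup>2"
proof -
  have L: "0 < L" using v by (auto simp: torus_V_def)
  define source where "source k = inv_into (torus_V L) (translate L k) v" for k
  have source: "source k \<in> torus_V L" "translate L k (source k) = v" for k
    using bij_betw_translate[OF L, of k] v
    by (simp_all add: source_def bij_betw_def inv_into_into f_inv_into_f)
  have source_unique: "p = source k" if "p \<in> torus_V L" "translate L k p = v" for p k
    using that source inj_on_translate[of L k] by (metis inj_onD)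
  have "{p \<in> torus_V L. v \<in> block L r p} = source ` ({..<r} \<times> {..<r})"
  proof (intro equalityI subsetI)
    fix p assume "p \<in> {p \<in> torus_V L. v \<in> block L r p}"
    then obtain k where "k \<in> {..<r} \<times> {..<r}" "p = source k"
      using source_unique unfolding block_def by blast
    then show "p \<in> source ` ({..<r} \<times> {..<r})" by blast
  next
    fix p assume "p \<in> source ` ({..<r} \<times> {..<r})"
    then obtain k where "k \<in> {..<r} \<times> {..<r}" "p = source k" by blast
    then show "p \<in> {p \<in> torus_V L. v \<in> block L r p}"
      using source[of k] unfolding block_def by blast
  qed
  moreover have "inj_on source ({..<r} \<times> {..<r})"
  proof (rule inj_onI)
    fix j k assume "j \<in> {..<r} \<times> {..<r}" "k \<in> {..<r} \<times> {..<r}" and eq: "source j = source k"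
    then have "j \<in> {..<L} \<times> {..<L}" "k \<in> {..<L} \<times> {..<L}" using r by auto
    moreover have "translate L j (source k) = translate L k (source k)"
      using source(2)[of j] source(2)[of k] eq by simp
    ultimately show "j = k" using inj_on_translate_offset by (metis (lifting) inj_onD)
  qed
  ultimately show ?thesis by (simp add: card_image power2_eq_square)
qed

lemma torus_adj_iff:
  "torus_adj L u v \<longleftrightarrow> u \<in> torus_V L \<and> v \<in> torus_V L \<and>
     (u = east L v \<or> v = east L u \<or> u = north L v \<or> v = north L u)"
  by (auto simp: torus_adj_def translate_def torus_V_def prod_eq_iff)

lemma torus_adj_sym: "torus_adj L u v \<longleftrightarrow> torus_adj L v u"
  by (auto simp: torus_adj_iff)

lemma torus_adj_irrefl:
  assumes "2 \<le> L"
  shows "\<not> torus_adj L u u"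
proof -
  have "x \<noteq> Suc x mod L" if "x < L" for x
    using that assms by (cases "x + 1 = L") auto
  then show ?thesis by (auto simp: torus_adj_def torus_V_def)
qed

lemma doubleton_in_torus_E: "{u, v} \<in> torus_E L \<longleftrightarrow> torus_adj L u v"
  unfolding torus_E_def using torus_adj_sym by (blast dest: doubleton_eq_iff[THEN iffD1])

lemma torus_E_cases:
  assumes "e \<in> torus_E L"
  obtains u where "u \<in> torus_V L" "e = {u, east L u} \<or> e = {u, north L u}"
  using assms by (auto simp: torus_E_def torus_adj_iff insert_commute)

lemma card_torus_E_le: "card (torus_E L) \<le> 2 * L\<^sup>2"
proof -
  let ?edges = "\<lambda>R. (\<lambda>u. {u, R u}) ` torus_V L"
  have "card (torus_E L) \<le> card (?edges (east L) \<union> ?edges (north L))"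
    by (intro card_mono) (auto elim!: torus_E_cases)
  also have "\<dots> \<le> card (?edges (east L)) + card (?edges (north L))" by (rule card_Un_le)
  also have "\<dots> \<le> card (torus_V L) + card (torus_V L)" by (intro add_mono card_image_le) simp_all
  finally show ?thesis by (simp add: card_torus_V)
qed

lemma torus_degree_le: "card {u. {v, u} \<in> torus_E L} \<le> 4"
proof -
  let ?offsets = "[(1, 0), (0, 1), (L - 1, 0), (0, L - 1)]"
  have undo: "translate L (L - 1, 0) (east L u) = u" "translate L (0, L - 1) (north L u) = u"
    if "u \<in> torus_V L" for u
    using that by (auto simp: translate_translate) (auto simp: translate_def torus_V_def)
  have "{u. {v, u} \<in> torus_E L} \<subseteq> set (map (\<lambda>k. translate L k v) ?offsets)"
    using undo by (auto simp: doubleton_in_torus_E torus_adj_iff)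
  then have "card {u. {v, u} \<in> torus_E L} \<le> card (set (map (\<lambda>k. translate L k v) ?offsets))"
    by (intro card_mono) simp_all
  also have "\<dots> \<le> length (map (\<lambda>k. translate L k v) ?offsets)" by (rule card_length)
  finally show ?thesis by simp
qed

lemma card_block_steps_le:
  assumes "0 < L" "r \<le> L" "S \<subseteq> block L r p"
  shows "r * card (steps_meeting_avoiding (torus_V L) (east L) S (block L r p - S))
      \<le> (r + 1) * card S" (is ?east)
    and "r * card (steps_meeting_avoiding (torus_V L) (north L) S (block L r p - S))
      \<le> (r + 1) * card S" (is ?north)
proof -
  have inj: "inj_on (\<lambda>k. translate L k p) ({..<r} \<times> {..<r})"
    using \<open>r \<le> L\<close> by (intro inj_on_subset[OF inj_on_translate_offset]) auto
  have swap: "(\<lambda>(j, k). translate L (k, j) p) = (\<lambda>k. translate L k p) \<circ> prod.swap" by auto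
  have swap_square: "prod.swap ` ({..<r} \<times> {..<r}) = {..<r} \<times> {..<r}" by auto
  show ?east
  proof (rule card_strip_steps_le[where J = "{..<r}" and e = "\<lambda>j k. translate L (k, j) p"])
    show "inj_on (\<lambda>(j, k). translate L (k, j) p) ({..<r} \<times> {..<r})"
      unfolding swap by (rule comp_inj_on) (simp_all only: swap_square inj inj_swap)
    show "(\<lambda>(j, k). translate L (k, j) p) ` ({..<r} \<times> {..<r}) = block L r p"
      unfolding swap image_comp[symmetric] swap_square block_def ..
  qed (use assms block_subset_torus_V in \<open>simp_all add: inj_on_translate translate_translate\<close>)
  show ?north
  proof (rule card_strip_steps_le[where J = "{..<r}" and e = "\<lambda>j k. translate L (j, k) p"])
    show "inj_on (\<lambda>(j, k). translate L (j, k) p) ({..<r} \<times> {..<r})"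
      using inj by (simp add: case_prod_unfold)
    show "(\<lambda>(j, k). translate L (j, k) p) ` ({..<r} \<times> {..<r}) = block L r p"
      by (simp add: block_def case_prod_unfold)
  qed (use assms block_subset_torus_V in \<open>simp_all add: inj_on_translate translate_translate\<close>)
qed

locale torus_potts =
  fixes L q :: nat and lam :: real
  assumes L_ge_2: "2 \<le> L" and lam_gt_1: "1 < lam" and colours_pos: "0 < q"
begin

sublocale potts_model "torus_V L" "torus_E L" 4 q lam
proof
  show "\<exists>u\<in>torus_V L. \<exists>v\<in>torus_V L. u \<noteq> v \<and> e = {u, v}" if "e \<in> torus_E L" for e
    using that torus_adj_irrefl[OF L_ge_2] unfolding torus_E_def torus_adj_iff by blast
qed (use L_ge_2 lam_gt_1 colours_pos torus_degree_le torus_V_nonempty in auto)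

lemma block_colour_sparse:
  assumes r: "1 \<le> r" "r \<le> L"
  shows "colour_sparse (2 + 2 / real r) (block L r p)"
  unfolding colour_sparse_def
proof (intro allI)
  fix \<sigma> c
  let ?S = "colour_class (block L r p) c \<sigma>"
  let ?M = "monochromatic_edges_meeting ?S \<sigma>"
  let ?steps = "\<lambda>R. steps_meeting_avoiding (torus_V L) R ?S (block L r p - ?S)"
  let ?edges = "\<lambda>R. (\<lambda>u. {u, R u}) ` ?steps R"
  have "?M \<subseteq> ?edges (east L) \<union> ?edges (north L)"
  proof
    fix e assume e: "e \<in> ?M"
    then have "\<forall>u\<in>e. \<sigma> u = c"
      by (fastforce simp: monochromatic_edges_meeting_def monochromatic_edges_def colour_class_def)
    then have avoid: "e \<inter> (block L r p - ?S) = {}" by (auto simp: colour_class_def)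
    from e have "e \<in> torus_E L" "e \<inter> ?S \<noteq> {}"
      by (simp_all add: monochromatic_edges_meeting_def monochromatic_edges_def)
    moreover obtain u where "u \<in> torus_V L" "e = {u, east L u} \<or> e = {u, north L u}"
      using \<open>e \<in> torus_E L\<close> by (rule torus_E_cases)
    ultimately show "e \<in> ?edges (east L) \<union> ?edges (north L)"
      using avoid unfolding steps_meeting_avoiding_def by blast
  qed
  then have "card ?M \<le> card (?edges (east L) \<union> ?edges (north L))"
    by (intro card_mono) auto
  also have "\<dots> \<le> card (?steps (east L)) + card (?steps (north L))"
    by (intro order_trans[OF card_Un_le] add_mono card_image_le) auto
  finally have "r * card ?M \<le> r * card (?steps (east L)) + r * card (?steps (north L))"
    by (simp flip: add_mult_distrib2)
  also have "\<dots> \<le> (r + 1) * card ?S + (r + 1) * card ?S"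
    using L_ge_2 r by (intro add_mono card_block_steps_le) (auto simp: colour_class_def)
  finally have "real (r * card ?M) \<le> real ((2 * r + 2) * card ?S)"
    by (intro of_nat_mono) simp
  then show "real (card ?M) \<le> (2 + 2 / real r) * real (card ?S)"
    using r(1) by (simp add: field_simps)
qed

lemma block_cover:
  assumes r: "1 \<le> r" "r \<le> L"
    and "16 * real (r\<^sup>2) * 2 ^ (r\<^sup>2 + 1) * colour_rate (2 + 2 / real r) \<le> 1"
  shows "sparse_block_cover (torus_V L) (torus_E L) 4 q lam (torus_V L) (block L r)
    (r\<^sup>2) (r\<^sup>2) (2 + 2 / real r)"
proof
  show "4 * real 4 * real (r\<^sup>2) * 2 ^ (r\<^sup>2 + 1) * colour_rate (2 + 2 / real r) \<le> 1"
    using assms(3) by simp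
qed (use L_ge_2 r block_colour_sparse card_blocks_containing card_block_le_square
    block_subset_torus_V in auto)

end

section \<open>Mixing time\<close>

lemma le_mult_ln_4_power_6:
  fixes n lam :: real
  assumes "1 < lam" "0 \<le> n"
  shows "n \<le> n * ln (4 * lam ^ 6)"
proof -
  have "exp 1 \<le> 4 * lam ^ 6" using exp_le one_le_power[of lam 6] assms(1) by linarith
  then have "1 \<le> ln (4 * lam ^ 6)" using assms(1) by (subst ln_ge_iff) auto
  then show ?thesis using mult_left_mono[OF _ assms(2)] by fastforce
qed

lemma mixing_bound_dominates:
  fixes n lam M :: real and r :: nat
  assumes lam: "1 < lam" and r: "1 \<le> r" and n: "1 \<le> n" and M: "1 \<le> M"
  shows "6 * (lam ^ (4 * r\<^sup>2) * n * M) + 1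
    \<le> 4 * (4 * lam ^ 8) ^ (r\<^sup>2 + 1) * n\<^sup>2 * ln (2 * exp 1 * n) * M"
proof -
  let ?K = "lam ^ (4 * r\<^sup>2)" and ?C = "(4 * lam ^ 8) ^ (r\<^sup>2 + 1)"
  have K: "1 \<le> ?K" using lam by (intro one_le_power) simp
  have "2 * ?K \<le> 4 ^ (r\<^sup>2 + 1) * (lam ^ 8) ^ (r\<^sup>2 + 1)"
  proof (rule mult_mono)
    have "(2 :: real) \<le> 4 ^ 1" by simp
    also have "\<dots> \<le> 4 ^ (r\<^sup>2 + 1)" by (intro power_increasing) auto
    finally show "(2 :: real) \<le> 4 ^ (r\<^sup>2 + 1)" .
    show "?K \<le> (lam ^ 8) ^ (r\<^sup>2 + 1)"
      unfolding power_mult[symmetric] using lam by (intro power_increasing) auto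
  qed (use lam in auto)
  then have C: "2 * ?K \<le> ?C" by (simp only: power_mult_distrib)
  have "exp 1 * 1 \<le> (2 * exp 1) * n" using n by (intro mult_mono) auto
  then have ln_ge_1: "1 \<le> ln (2 * exp 1 * n)" using n by (subst ln_ge_iff) auto
  have "1 \<le> ?K * n * M"
    using mult_mono[of 1 "?K * n" 1 M] mult_mono[of 1 ?K 1 n] K n M by simp
  then have "6 * (?K * n * M) + 1 \<le> 4 * (2 * ?K) * (n * 1) * 1 * M" by (simp add: mult_ac)
  also have "\<dots> \<le> 4 * ?C * (n * n) * ln (2 * exp 1 * n) * M"
    using C n M K ln_ge_1 order_trans[OF zero_le_one ln_ge_1]
    by (intro mult_mono mult_nonneg_nonneg) auto
  finally show ?thesis by (simp add: power2_eq_square)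
qed

context torus_potts
begin

lemma states_eq_configs: "states = configs L q"
  by (simp add: states_def configs_def)

lemma weight_eq: "weight \<sigma> = lam ^ mono_edges L \<sigma>"
  by (simp add: weight_def monochromatic_edges_def mono_edges_def)

lemma gibbs_eq: "gibbs L lam q \<sigma> = weight \<sigma> / total_weight"
  by (simp add: gibbs_def total_weight_def weight_eq states_eq_configs)

lemma nbr_count_eq: "nbr_count L X v c = card {u \<in> neighbours v. X u = c}"
proof -
  have "{u \<in> torus_V L. torus_adj L v u \<and> X u = c} = {u \<in> neighbours v. X u = c}"
    by (auto simp: neighbours_def doubleton_in_torus_E torus_adj_def)
  then show ?thesis by (simp add: nbr_count_def)
qed

lemma cond_exp_site:
  assumes v: "v \<in> torus_V L" and X: "X \<in> states"
  shows "cond_exp {v} f X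
    = (\<Sum>c<q. lam ^ nbr_count L X v c / (\<Sum>c'<q. lam ^ nbr_count L X v c') * f (X(v := c)))"
proof -
  let ?a = "lam ^ card {e \<in> monochromatic_edges X. v \<notin> e}" and ?n = "\<lambda>c. lam ^ nbr_count L X v c"
  have "cond_exp {v} f X = (?a * (\<Sum>c<q. ?n c * f (X(v := c)))) / (?a * (\<Sum>c<q. ?n c))"
    unfolding cond_exp_singleton[OF v X] weight_upd nbr_count_eq
    by (simp only: sum_distrib_left mult.assoc)
  also have "\<dots> = (\<Sum>c<q. ?n c * f (X(v := c))) / (\<Sum>c<q. ?n c)"
    using lam_gt_1 by simp
  finally show ?thesis by (simp add: sum_divide_distrib)
qed

lemma glauber_P_eq_update:
  assumes "X \<in> states"
  shows "glauber_P L lam q X Y = sites.update (\<lambda>Z. of_bool (Z = Y)) X"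
proof -
  have "(\<Sum>c<q. if Y = X(v := c)
        then lam ^ nbr_count L X v c / (\<Sum>c'<q. lam ^ nbr_count L X v c') else 0)
      = cond_exp {v} (\<lambda>Z. of_bool (Z = Y)) X" if "v \<in> torus_V L" for v
    unfolding cond_exp_site[OF that assms] by (intro sum.cong) auto
  then show ?thesis by (simp add: glauber_P_def block_avg_def)
qed

lemma glauber_Pt_eq_kernel:
  assumes "X \<in> states"
  shows "glauber_Pt L lam q t X Y = sites.kernel t X Y"
proof (induction t arbitrary: Y)
  case 0
  show ?case by (simp add: sites.kernel_def)
next
  case (Suc t)
  have "glauber_Pt L lam q (Suc t) X Y
      = (\<Sum>Z\<in>states. sites.kernel t X Z * sites.update (\<lambda>Z. of_bool (Z = Y)) Z)"
    by (simp add: Suc glauber_P_eq_update flip: states_eq_configs)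
  also have "\<dots> = (sites.update ^^ t) (sites.update (\<lambda>Z. of_bool (Z = Y))) X"
    by (rule sites.funpow_update_eq_sum_kernel[OF assms, symmetric])
  also have "\<dots> = sites.kernel (Suc t) X Y"
    by (simp add: sites.kernel_def funpow_swap1)
  finally show ?case .
qed

lemma tv_dist_eq: "X \<in> states \<Longrightarrow> tv_dist L lam q t X = sites.tv_to_equilibrium t X"
  by (simp add: tv_dist_def sites.tv_to_equilibrium_def glauber_Pt_eq_kernel gibbs_eq
      flip: states_eq_configs)

lemma states_nonempty: "states \<noteq> {}"
  using colours_pos by (auto simp: states_def PiE_eq_empty_iff)

lemma mixing_time_le:
  assumes "0 \<le> x" and tv: "\<And>X t. X \<in> states \<Longrightarrow> x \<le> real t \<Longrightarrow> sites.tv_to_equilibrium t X \<le> \<epsilon>"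
  shows "real (mixing_time L lam q \<epsilon>) \<le> x + 1"
proof -
  let ?t = "nat \<lceil>x\<rceil>"
  have "(LEAST t. tv_dist L lam q t X \<le> \<epsilon>) \<le> ?t" if "X \<in> states" for X
    by (rule Least_le) (simp add: tv_dist_eq that tv real_nat_ceiling_ge)
  then have "mixing_time L lam q \<epsilon> \<le> ?t"
    unfolding mixing_time_def states_eq_configs[symmetric]
    using states_nonempty by (subst Max_le_iff) auto
  then show ?thesis using \<open>0 \<le> x\<close> by linarith
qed

lemma ln_total_weight_bound_le:
  assumes "real q \<le> 64 * lam ^ 4"
  shows "ln (real q ^ card (torus_V L) * lam ^ card (torus_E L))
    \<le> 3 * (real L ^ 2 * ln (4 * lam ^ 6))"
proof -
  have "real q ^ card (torus_V L) * lam ^ card (torus_E L) \<le> real q ^ L\<^sup>2 * lam ^ (2 * L\<^sup>2)"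
    using lam_gt_1 colours_pos
    by (intro mult_mono power_increasing card_torus_E_le) (simp_all add: card_torus_V Suc_le_eq)
  also have "\<dots> = (real q * lam ^ 2) ^ L\<^sup>2" by (simp add: power_mult_distrib power_mult)
  also have "\<dots> \<le> ((4 * lam ^ 6) ^ 3) ^ L\<^sup>2"
  proof (rule power_mono)
    have "real q * lam ^ 2 \<le> 64 * lam ^ 4 * lam ^ 2" using assms by (rule mult_right_mono) simp
    also have "\<dots> = 64 * lam ^ 6" by (simp flip: power_add)
    also have "\<dots> \<le> 64 * lam ^ 18" using lam_gt_1 by (intro mult_left_mono power_increasing) auto
    also have "\<dots> = (4 * lam ^ 6) ^ 3" by (simp add: power_mult_distrib flip: power_mult)
    finally show "real q * lam ^ 2 \<le> (4 * lam ^ 6) ^ 3" .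
  qed (use lam_gt_1 in simp)
  finally have "ln (real q ^ card (torus_V L) * lam ^ card (torus_E L))
      \<le> ln (((4 * lam ^ 6) ^ 3) ^ L\<^sup>2)"
    using lam_gt_1 colours_pos by (intro ln_mono) simp_all
  also have "\<dots> = real (L\<^sup>2) * (3 * ln (4 * lam ^ 6))"
    using lam_gt_1 by (simp only: ln_realpow zero_less_power zero_less_mult_iff)
  finally show ?thesis by simp
qed

lemma glauber_tv_le:
  assumes r: "1 \<le> r" "r \<le> L"
    and rate: "16 * real (r\<^sup>2) * 2 ^ (r\<^sup>2 + 1) * colour_rate (2 + 2 / real r) \<le> 1"
    and \<epsilon>: "0 < \<epsilon>" "\<epsilon> < 1" and X: "X \<in> states"
    and t: "6 * (lam ^ (4 * r\<^sup>2) * real L ^ 2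
      * (real L ^ 2 * ln (4 * lam ^ 6) + ln (1 / \<epsilon>))) \<le> real t"
  shows "sites.tv_to_equilibrium t X \<le> \<epsilon>"
proof -
  let ?n = "real L ^ 2" and ?K = "lam ^ (4 * r\<^sup>2)"
  let ?M = "?n * ln (4 * lam ^ 6) + ln (1 / \<epsilon>)"
  have n: "1 \<le> ?n" "real (card (torus_V L)) = ?n"
    using L_ge_2 by (simp_all add: card_torus_V)
  have K: "1 \<le> ?K" using lam_gt_1 by (intro one_le_power) simp
  have ln_\<epsilon>: "0 \<le> ln (1 / \<epsilon>)" using \<epsilon> by simp
  show ?thesis
  proof (cases "64 * lam ^ 4 \<le> real q")
    case True
    have "ln ?n + ln (1 / \<epsilon>) \<le> ?M"
      using le_mult_ln_4_power_6[OF lam_gt_1, of ?n] ln_le_minus_one[of ?n] n(1) by linarith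
    then have "2 * ?n * (ln ?n + ln (1 / \<epsilon>)) \<le> (6 * (?K * ?n)) * ?M"
      using n K ln_\<epsilon> mult_right_mono[OF K, of ?n] by (intro mult_mono) auto
    also have "\<dots> \<le> real t" using t by (simp only: mult.assoc)
    finally show ?thesis
      using True n by (intro sites_tv_le_of_many_colours X \<epsilon>) simp_all
  next
    case False
    interpret cover: sparse_block_cover "torus_V L" "torus_E L" 4 q lam "torus_V L" "block L r"
        "r\<^sup>2" "r\<^sup>2" "2 + 2 / real r"
      by (rule block_cover[OF r rate])
    let ?entropy = "ln (real q ^ card (torus_V L) * lam ^ card (torus_E L))"
    have "?entropy + 2 * ln (1 / \<epsilon>) \<le> 3 * ?M"
      using ln_total_weight_bound_le False ln_\<epsilon> by simp
    then have "2 * ?K * ?n * (?entropy + 2 * ln (1 / \<epsilon>)) \<le> 2 * ?K * ?n * (3 * ?M)"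
      using n K by (intro mult_left_mono) auto
    also have "\<dots> = 6 * (?K * ?n * ?M)" by (simp add: algebra_simps)
    also have "\<dots> \<le> real t" by (rule t)
    finally show ?thesis
      by (intro cover.sites_tv_le X \<epsilon>) (simp only: n(2))
  qed
qed

lemma colour_rate_small:
  assumes r: "1 \<le> r"
    and q: "2 ^ (r\<^sup>2 + 8 * r + 3) * real r ^ (2 * r\<^sup>2 + 4 * r + 1) * lam powr (2 + 2 / real r)
      \<le> real q"
  shows "16 * real (r\<^sup>2) * 2 ^ (r\<^sup>2 + 1) * colour_rate (2 + 2 / real r) \<le> 1"
proof -
  let ?\<Lambda> = "lam powr (2 + 2 / real r)"
  have "16 * real (r\<^sup>2) * 2 ^ (r\<^sup>2 + 1) = 2 ^ (r\<^sup>2 + 5) * real r ^ 2"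
    by (simp add: power_add)
  also have "\<dots> \<le> 2 ^ (r\<^sup>2 + 8 * r + 3) * real r ^ (2 * r\<^sup>2 + 4 * r + 1)"
    using r by (intro mult_mono power_increasing) auto
  finally have "16 * real (r\<^sup>2) * 2 ^ (r\<^sup>2 + 1) * ?\<Lambda>
      \<le> 2 ^ (r\<^sup>2 + 8 * r + 3) * real r ^ (2 * r\<^sup>2 + 4 * r + 1) * ?\<Lambda>"
    by (rule mult_right_mono) simp
  with q have "16 * real (r\<^sup>2) * 2 ^ (r\<^sup>2 + 1) * ?\<Lambda> \<le> real q" by linarith
  then show ?thesis using colours_pos by (simp add: colour_rate_def)
qed

end

theorem theorem2p15:
  fixes L q r :: nat and lam \<epsilon> :: real
  assumes "lam > 1"
    and "r \<ge> 1" and "r + 2 \<le> L"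
    and "real q \<ge> 2 ^ (r^2 + 8*r + 3) * real r ^ (2*r^2 + 4*r + 1) * lam powr (2 + 2 / real r)"
    and "\<epsilon> > 0" and "\<epsilon> < 1"
  shows "real (mixing_time L lam q \<epsilon>) \<le>
     4 * (4 * lam ^ 8) ^ (r^2 + 1) * (real L ^ 2) ^ 2 * ln (2 * exp 1 * real L ^ 2) *
     (real L ^ 2 * ln (4 * lam ^ 6) + ln (1 / \<epsilon>))"
proof -
  let ?n = "real L ^ 2"
  let ?M = "?n * ln (4 * lam ^ 6) + ln (1 / \<epsilon>)"
  have "0 < 2 ^ (r^2 + 8*r + 3) * real r ^ (2*r^2 + 4*r + 1) * lam powr (2 + 2 / real r)"
    using assms(1,2) by simp
  then have "0 < q" using assms(4) by (metis less_le_trans of_nat_0_less_iff)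
  then interpret torus_potts L q lam
    using assms(1,3) by unfold_locales auto
  have n: "1 \<le> ?n" using assms(3) by (intro one_le_power) simp
  moreover have "0 \<le> ln (1 / \<epsilon>)" using assms(5,6) by simp
  ultimately have M: "1 \<le> ?M" using le_mult_ln_4_power_6[OF assms(1), of ?n] by linarith
  have "real (mixing_time L lam q \<epsilon>) \<le> 6 * (lam ^ (4 * r\<^sup>2) * ?n * ?M) + 1"
  proof (rule mixing_time_le)
    show "0 \<le> 6 * (lam ^ (4 * r\<^sup>2) * ?n * ?M)" using assms(1) M by simp
  qed (use assms in \<open>intro glauber_tv_le[OF _ _ colour_rate_small]; simp\<close>)
  also have "\<dots> \<le> 4 * (4 * lam ^ 8) ^ (r^2 + 1) * ?n ^ 2 * ln (2 * exp 1 * ?n) * ?M"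
    by (rule mixing_bound_dominates[OF assms(1,2) n M])
  finally show ?thesis by (simp only: mult.assoc)
qed

end
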